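(* A graph $G$ is a polygonal 2-tree if and only if $G$ is a 2-connected partial 2-tree and the set of induced cycles of $G$ is a cycle basis of $G$.
   Context: All graphs are finite, simple, undirected and unweighted. A polygonal 2-tree is defined recursively: every cycle is a polygonal 2-tree; if $G$ is a polygonal 2-tree and $(u,v) \in E(G)$, then adding a new path $P$ between $u$ and $v$ with $E(G) \cap E(P) = \emptyset$, $V(G) \cap V(P) = \{u,v\}$ and $|E(P)| \geq 2$ yields a polygonal 2-tree. A 2-tree is obtained from a triangle by repeatedly choosing an edge $(u,v)$ and adding a new vertex adjacent to both $u$ and $v$; a partial 2-tree is a subgraph of a 2-tree. An induced cycle is a chordless cycle. A graph is Eulerian if every vertex has even degree. For subgraphs $H_1,\ldots,H_k$, $H_1 \oplus \cdots \oplus H_k$ is the graph consisting of the edges appearing in an odd number of the $H_i$. A cycle basis of $G$ is a minimal set $\mathcal{B}$ of Eulerian subgraphs of $G$ such that every cycle of $G$ is the $\oplus$-sum of a subset of $\mathcal{B}$. *)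

theory Defs
  imports
    "Graph_Theory.Pair_Digraph"
    "Graph_Theory.Digraph_Component"
    "Graph_Theory.Digraph_Isomorphism"
begin

text \<open>
  A finite simple undirected graph is a \<^verbatim>\<open>pair_graph\<close>: a finite, loop-free, symmetric digraph
  without parallel arcs. An undirected edge is thus a pair of opposite arcs.
\<close>

definition uedges :: "'a pair_pre_digraph \<Rightarrow> 'a set set" where
  "uedges G = {{u, v} | u v. (u, v) \<in> parcs G}"

definition graph_union :: "'a pair_pre_digraph \<Rightarrow> 'a pair_pre_digraph \<Rightarrow> 'a pair_pre_digraph" where
  "graph_union G H = \<lparr>pverts = pverts G \<union> pverts H, parcs = parcs G \<union> parcs H\<rparr>"

definition path_graph :: "'a list \<Rightarrow> 'a pair_pre_digraph" where
  "path_graph xs =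
     \<lparr>pverts = set xs, parcs = (let A = set (zip xs (tl xs)) in A \<union> A\<inverse>)\<rparr>"

definition is_path :: "'a \<Rightarrow> 'a pair_pre_digraph \<Rightarrow> 'a \<Rightarrow> bool" where
  "is_path u P v \<longleftrightarrow>
     (\<exists>xs. xs \<noteq> [] \<and> distinct xs \<and> hd xs = u \<and> last xs = v \<and> P = path_graph xs)"

definition cycle_graph :: "'a list \<Rightarrow> 'a pair_pre_digraph" where
  "cycle_graph xs =
     \<lparr>pverts = set xs, parcs = (let A = set (zip xs (rotate1 xs)) in A \<union> A\<inverse>)\<rparr>"

text \<open>
  The library's \<^verbatim>\<open>pre_digraph.cycle\<close> is not used: in a symmetric digraph it also admits the closed
  walk that runs along an edge and straight back.
\<close>

definition is_cycle :: "'a pair_pre_digraph \<Rightarrow> bool" where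
  "is_cycle C \<longleftrightarrow> (\<exists>xs. distinct xs \<and> 3 \<le> length xs \<and> C = cycle_graph xs)"

inductive polygonal_2_tree :: "'a pair_pre_digraph \<Rightarrow> bool" where
  cycle: "is_cycle C \<Longrightarrow> polygonal_2_tree C"
| add_path: "\<lbrakk>polygonal_2_tree G; {u, v} \<in> uedges G; is_path u P v;
     uedges G \<inter> uedges P = {}; pverts G \<inter> pverts P = {u, v}; 2 \<le> card (uedges P)\<rbrakk>
   \<Longrightarrow> polygonal_2_tree (graph_union G P)"

inductive two_tree :: "'a pair_pre_digraph \<Rightarrow> bool" where
  triangle: "distinct [x, y, z] \<Longrightarrow> two_tree (cycle_graph [x, y, z])"
| add_vertex: "\<lbrakk>two_tree T; {u, v} \<in> uedges T; w \<notin> pverts T\<rbrakk>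
   \<Longrightarrow> two_tree \<lparr>pverts = insert w (pverts T),
                 parcs = parcs T \<union> {(u, w), (w, u), (v, w), (w, v)}\<rparr>"

text \<open>
  The ambient 2-tree may have vertices outside \<open>G\<close>, of which the type \<^typ>\<open>'a\<close> need not contain
  enough. Hence it lives on natural numbers and contains an isomorphic copy of \<open>G\<close>.
\<close>

definition partial_2_tree :: "'a pair_pre_digraph \<Rightarrow> bool" where
  "partial_2_tree G \<longleftrightarrow>
     (\<exists>(H :: nat pair_pre_digraph) (T :: nat pair_pre_digraph).
        digraph_iso (with_proj G) (with_proj H) \<and> subgraph (with_proj H) (with_proj T) \<and>
        two_tree T)"

definition two_connected :: "'a pair_pre_digraph \<Rightarrow> bool" where
  "two_connected G \<longleftrightarrow>
     3 \<le> card (pverts G) \<and> connected (with_proj G) \<and>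
     (\<forall>v \<in> pverts G. connected (pre_digraph.del_vert (with_proj G) v))"

definition induced_cycle :: "'a pair_pre_digraph \<Rightarrow> 'a pair_pre_digraph \<Rightarrow> bool" where
  "induced_cycle G C \<longleftrightarrow> is_cycle C \<and> induced_subgraph (with_proj C) (with_proj G)"

text \<open>For a symmetric digraph the undirected degree is \<^const>\<open>out_degree\<close>.\<close>

definition eulerian :: "'a pair_pre_digraph \<Rightarrow> bool" where
  "eulerian H \<longleftrightarrow> (\<forall>v \<in> pverts H. even (out_degree (with_proj H) v))"

definition ring_sum :: "'a pair_pre_digraph set \<Rightarrow> 'a pair_pre_digraph" where
  "ring_sum S =
     (let A = {a. odd (card {H \<in> S. a \<in> parcs H})} in \<lparr>pverts = Field A, parcs = A\<rparr>)"

definition generates_cycles :: "'a pair_pre_digraph \<Rightarrow> 'a pair_pre_digraph set \<Rightarrow> bool" where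
  "generates_cycles G B \<longleftrightarrow>
     (\<forall>C. is_cycle C \<and> subgraph (with_proj C) (with_proj G) \<longrightarrow> (\<exists>S \<subseteq> B. C = ring_sum S))"

definition cycle_basis :: "'a pair_pre_digraph \<Rightarrow> 'a pair_pre_digraph set \<Rightarrow> bool" where
  "cycle_basis G B \<longleftrightarrow>
     (\<forall>H \<in> B. pair_graph H \<and> subgraph (with_proj H) (with_proj G) \<and> eulerian H) \<and>
     generates_cycles G B \<and>
     (\<forall>B'. B' \<subset> B \<longrightarrow> \<not> generates_cycles G B')"

end

theory Submission
  imports Defs
begin

text \<open>
  Forward direction: adding an ear \<open>P\<close> along an edge \<open>uv\<close> adds exactly one induced cycle
  \<open>D = P + uv\<close>. An even edge set either avoids \<open>P\<close> or contains all of it, so adding \<open>D\<close> if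
  necessary moves it into the smaller graph; and \<open>D\<close> is the only induced cycle that uses the edges
  of \<open>P\<close>. Generation and independence follow by induction.

  Converse: minimality of the basis forbids three induced cycles with \<open>C3 = C1 \<oplus> C2\<close>.
  A 2-connected partial 2-tree with at least four vertices has
  a vertex \<open>w\<close> with exactly two neighbours \<open>a\<close>, \<open>b\<close> such that \<open>G' = G - w + ab\<close> is again a
  2-connected partial 2-tree without such a relation; by induction \<open>G'\<close> is polygonal. If \<open>ab\<close> is an
  edge of \<open>G\<close>, then \<open>w\<close> is an ear of \<open>G'\<close>. Otherwise \<open>G\<close> subdivides the edge \<open>ab\<close> of \<open>G'\<close>: this
  leaves a polygonal 2-tree if only one polygon contains \<open>ab\<close>, while two polygons through \<open>ab\<close>,
  subdivided, form a theta graph whose three cycles are induced and sum to zero.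
\<close>

section \<open>Simple graphs as finite symmetric irreflexive relations\<close>

lemma pair_graph_iff:
  "pair_graph G \<longleftrightarrow> finite (pverts G) \<and> parcs G \<subseteq> pverts G \<times> pverts G \<and> sym (parcs G)
     \<and> irrefl (parcs G)"
proof
  assume "pair_graph G"
  then interpret pair_graph G .
  show "finite (pverts G) \<and> parcs G \<subseteq> pverts G \<times> pverts G \<and> sym (parcs G) \<and> irrefl (parcs G)"
    using pair_finite_verts pair_no_loops arcs_symmetric in_arcsD1 in_arcsD2
    by (fastforce simp: irrefl_def intro!: symI)
next
  assume *: "finite (pverts G) \<and> parcs G \<subseteq> pverts G \<times> pverts G \<and> sym (parcs G)
    \<and> irrefl (parcs G)"
  show "pair_graph G"
  proof
    show "finite (parcs G)"
      using * finite_subset by blast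
    show "symmetric (with_proj G)"
      using * by (simp add: symmetric_def)
  qed (use * in \<open>auto simp: irrefl_def\<close>)
qed

lemma pair_wf_digraph_iff: "pair_wf_digraph G \<longleftrightarrow> parcs G \<subseteq> pverts G \<times> pverts G"
  by (force simp: pair_wf_digraph_def)

lemma subgraph_with_proj_iff:
  "subgraph (with_proj H) (with_proj G) \<longleftrightarrow> pverts H \<subseteq> pverts G \<and> parcs H \<subseteq> parcs G
     \<and> parcs G \<subseteq> pverts G \<times> pverts G \<and> parcs H \<subseteq> pverts H \<times> pverts H"
  by (auto simp: subgraph_def compatible_def wf_digraph_wp_iff pair_wf_digraph_iff)

lemma doubleton_in_uedges_iff: "sym (parcs G) \<Longrightarrow> {u, v} \<in> uedges G \<longleftrightarrow> (u, v) \<in> parcs G"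
  by (auto simp: uedges_def doubleton_eq_iff dest: symD)

section \<open>Arcs of paths and cycles\<close>

text \<open>Replaces the \<open>zip\<close> in \<open>path_graph\<close> by a recursion that
  produces both directions of each edge at once, so that facts about paths follow by induction on
  the list.\<close>

fun path_arcs :: "'a list \<Rightarrow> 'a rel" where
  "path_arcs (x # y # zs) = {(x, y), (y, x)} \<union> path_arcs (y # zs)"
| "path_arcs _ = {}"

lemma pverts_path_graph [simp]: "pverts (path_graph xs) = set xs"
  by (simp add: path_graph_def)

lemma parcs_path_graph [simp]: "parcs (path_graph xs) = path_arcs xs"
  by (induction xs rule: path_arcs.induct) (auto simp: path_graph_def Let_def)

lemma path_arcs_subset: "path_arcs xs \<subseteq> set xs \<times> set xs"
  by (induction xs rule: path_arcs.induct) auto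

lemma path_arcsD: "(x, y) \<in> path_arcs xs \<Longrightarrow> x \<in> set xs \<and> y \<in> set xs"
  using path_arcs_subset by fast

lemma sym_path_arcs: "sym (path_arcs xs)"
  by (induction xs rule: path_arcs.induct) (auto simp: sym_def)

lemma path_arcs_commute: "(x, y) \<in> path_arcs xs \<longleftrightarrow> (y, x) \<in> path_arcs xs"
  using sym_path_arcs by (metis symD)

lemma irrefl_path_arcs: "distinct xs \<Longrightarrow> irrefl (path_arcs xs)"
  by (induction xs rule: path_arcs.induct) (auto simp: irrefl_def)

text \<open>Both parts keep the vertex \<open>y\<close> at which the path is cut, so no arc is
  lost.\<close>

lemma path_arcs_append: "path_arcs (xs @ y # zs) = path_arcs (xs @ [y]) \<union> path_arcs (y # zs)"
  by (induction xs rule: path_arcs.induct) auto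

lemma path_arcs_snoc2: "path_arcs (xs @ [y, z]) = path_arcs (xs @ [y]) \<union> {(y, z), (z, y)}"
  by (subst path_arcs_append) simp

lemma path_arcs_rev: "path_arcs (rev xs) = path_arcs xs"
proof (induction xs rule: path_arcs.induct)
  case (1 x y zs)
  then show ?case
    by (simp add: path_arcs_snoc2) blast
qed auto

lemma path_arcs_split:
  "(a, b) \<in> path_arcs xs \<Longrightarrow> \<exists>ps qs. xs = ps @ a # b # qs \<or> xs = ps @ b # a # qs"
proof (induction xs rule: path_arcs.induct)
  case (1 x y zs)
  then consider "(a, b) = (x, y) \<or> (a, b) = (y, x)" | "(a, b) \<in> path_arcs (y # zs)"
    by auto
  then show ?case
  proof cases
    case 1
    then show ?thesis by blast
  next
    case 2
    then obtain ps qs where "y # zs = ps @ a # b # qs \<or> y # zs = ps @ b # a # qs"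
      using 1 by blast
    then show ?thesis
      by (metis append_Cons)
  qed
qed auto

text \<open>Consecutive positions are both end positions only in a list of length two. This makes
  every arc of an ear new to the graph it is attached to.\<close>

lemma path_arcs_inner:
  assumes "(x, y) \<in> path_arcs (u # ys @ [v])" "ys \<noteq> []"
  shows "x \<in> set ys \<or> y \<in> set ys"
  using assms
proof (induction ys arbitrary: u)
  case (Cons z zs)
  then show ?case
    by (cases "zs = []") auto
qed auto

lemma path_arcs_ends:
  assumes "ys \<noteq> []"
  shows "(u, hd ys) \<in> path_arcs (u # ys @ [v])" "(last ys, v) \<in> path_arcs (u # ys @ [v])"
proof -
  show "(u, hd ys) \<in> path_arcs (u # ys @ [v])"
    using assms by (cases ys) auto
  show "(last ys, v) \<in> path_arcs (u # ys @ [v])"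
    using assms by (cases ys rule: rev_cases) (use path_arcs_snoc2[of "u # butlast ys"] in auto)
qed

text \<open>Distinctness keeps \<open>y\<close> out of the rest of the list, so only the two arcs
  around it can start there.\<close>

lemma path_arcs_middle:
  assumes "distinct (ps @ x # y # z # qs)" "(y, t) \<in> path_arcs (ps @ x # y # z # qs)"
  shows "t = x \<or> t = z"
proof -
  have "path_arcs (ps @ x # y # z # qs)
      = path_arcs (ps @ [x]) \<union> {(x, y), (y, x), (y, z), (z, y)} \<union> path_arcs (z # qs)"
    by (subst path_arcs_append) auto
  then show ?thesis
    using assms by (auto dest: path_arcsD)
qed

lemma pverts_cycle_graph [simp]: "pverts (cycle_graph xs) = set xs"
  by (simp add: cycle_graph_def)

lemma parcs_cycle_graph: "parcs (cycle_graph (x # xs)) = path_arcs (x # xs @ [x])"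
proof -
  \<comment> \<open>The second list is \<open>rotate1 (x # xs)\<close>. The entry appended to the
    first list is discarded by \<open>zip\<close>, so a cycle becomes a closed path returning to its
    start.\<close>
  have "zip (x # xs) (xs @ [x]) = zip (x # xs @ [x]) (xs @ [x])"
    by (rule nth_equalityI) (auto simp: nth_append nth_Cons')
  then show ?thesis
    unfolding parcs_path_graph[symmetric] by (simp add: cycle_graph_def path_graph_def)
qed

text \<open>The form used throughout: a path plus the edge that closes it, which lets a cycle be
  read as an ear over that edge.\<close>

lemma parcs_cycle_graph_ends:
  "parcs (cycle_graph (a # ys @ [b])) = path_arcs (a # ys @ [b]) \<union> {(a, b), (b, a)}"
  using path_arcs_snoc2[of "a # ys" b a] by (auto simp: parcs_cycle_graph)

lemma is_cycleI: "distinct (a # ys @ [b]) \<Longrightarrow> ys \<noteq> [] \<Longrightarrow> is_cycle (cycle_graph (a # ys @ [b]))"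
  unfolding is_cycle_def by (rule exI[of _ "a # ys @ [b]"]) (cases ys, auto)

text \<open>Rotating and, if necessary, reversing the vertex list brings any chosen edge into the
  closing position.\<close>

lemma is_cycle_through_arc:
  assumes "is_cycle C" "(a, b) \<in> parcs C"
  obtains ys where "ys \<noteq> []" "distinct (a # ys @ [b])" "C = cycle_graph (a # ys @ [b])"
proof -
  obtain xs where xs: "distinct xs" "3 \<le> length xs" "C = cycle_graph xs"
    using assms(1) by (auto simp: is_cycle_def)
  obtain h t where ht: "xs = h # t"
    using xs(2) by (cases xs) auto
  \<comment> \<open>In the closed list \<open>xs @ [h]\<close> the closing edge is an ordinary
    consecutive pair. If \<open>a\<close> precedes \<open>b\<close> there, the rest of the cycle
    runs from \<open>b\<close> to \<open>a\<close>; one of the two orientations below therefore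
    needs a reversal.\<close>
  have *: "\<exists>ys. distinct (b # ys @ [a]) \<and> set xs = set (b # ys @ [a])
      \<and> parcs C = path_arcs (b # ys @ [a]) \<union> {(a, b), (b, a)} \<and> length xs = length ys + 2"
    if eq: "xs @ [h] = ps @ a # b # qs" for a b ps qs
  proof (cases qs rule: rev_cases)
    case Nil
    then have b: "b = h" and xs_eq: "xs = ps @ [a]"
      using eq by auto
    moreover have "ps \<noteq> []"
      using xs_eq xs(2) by auto
    ultimately obtain ys where "ps = b # ys"
      using ht by (cases ps) auto
    then show ?thesis
      using xs xs_eq by (intro exI[of _ ys]) (auto simp: parcs_cycle_graph_ends)
  next
    case (snoc qs' h')
    then have h: "h' = h" and xs_eq: "xs = ps @ a # b # qs'"
      using eq by auto
    have arcs: "parcs C = path_arcs (ps @ [a]) \<union> {(a, b), (b, a)} \<union> path_arcs (b # qs' @ [h])"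
    proof -
      have "parcs C = path_arcs (xs @ [h])"
        using xs(3) ht by (simp add: parcs_cycle_graph)
      then show ?thesis
        using path_arcs_append[of ps a "b # qs' @ [h]"] xs_eq by auto
    qed
    obtain r where r: "ps @ [a] = h # r"
      using ht xs_eq by (cases ps) auto
    \<comment> \<open>The pieces after and before the arc are rejoined at \<open>h\<close>, where
      the closed list ends and starts.\<close>
    have "path_arcs (b # qs' @ ps @ [a]) = path_arcs (b # qs' @ [h]) \<union> path_arcs (ps @ [a])"
      using path_arcs_append[of "b # qs'" h r] r by simp
    then show ?thesis
      using xs xs_eq arcs by (intro exI[of _ "qs' @ ps"]) auto
  qed
  have "(a, b) \<in> path_arcs (xs @ [h])"
    using assms(2) xs(3) ht by (simp add: parcs_cycle_graph)
  then obtain ps qs where "xs @ [h] = ps @ a # b # qs \<or> xs @ [h] = ps @ b # a # qs"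
    using path_arcs_split by fast
  then have "\<exists>ys. distinct (a # ys @ [b]) \<and> set xs = set (a # ys @ [b])
      \<and> parcs C = path_arcs (a # ys @ [b]) \<union> {(a, b), (b, a)} \<and> length xs = length ys + 2"
  proof
    assume "xs @ [h] = ps @ a # b # qs"
    from *[OF this] obtain ys where ys: "distinct (b # ys @ [a])" "set xs = set (b # ys @ [a])"
      "parcs C = path_arcs (b # ys @ [a]) \<union> {(a, b), (b, a)}" "length xs = length ys + 2"
      by blast
    moreover have "path_arcs (a # rev ys @ [b]) = path_arcs (b # ys @ [a])"
      using path_arcs_rev[of "b # ys @ [a]"] by simp
    ultimately show ?thesis
      by (intro exI[of _ "rev ys"]) auto
  next
    assume "xs @ [h] = ps @ b # a # qs"
    from *[OF this] show ?thesis
      by (simp add: insert_commute)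
  qed
  then obtain ys where ys: "distinct (a # ys @ [b])" "set xs = set (a # ys @ [b])"
      "parcs C = path_arcs (a # ys @ [b]) \<union> {(a, b), (b, a)}" "length xs = length ys + 2"
    by blast
  show ?thesis
  proof (rule that)
    show "ys \<noteq> []"
      using ys xs by auto
    show "C = cycle_graph (a # ys @ [b])"
      using ys xs by (intro pair_pre_digraph.equality) (auto simp: parcs_cycle_graph_ends)
  qed fact
qed

lemma is_cycle_form:
  assumes "is_cycle C"
  obtains a b ys where "ys \<noteq> []" "distinct (a # ys @ [b])" "C = cycle_graph (a # ys @ [b])"
proof -
  obtain xs where xs: "distinct xs" "3 \<le> length xs" "C = cycle_graph xs"
    using assms by (auto simp: is_cycle_def)
  then obtain a t where "xs = a # t" "t \<noteq> []"
    by (cases xs) fastforce+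
  moreover then obtain ys b where "t = ys @ [b]"
    by (meson rev_exhaust)
  ultimately show ?thesis
    using xs that[of ys a b] by force
qed

lemma pair_graph_cycle:
  assumes "is_cycle C"
  shows "pair_graph C"
proof -
  obtain a b ys where C: "distinct (a # ys @ [b])" "C = cycle_graph (a # ys @ [b])"
    using assms by (rule is_cycle_form)
  then show ?thesis
    using irrefl_path_arcs[OF C(1)]
    by (auto simp: pair_graph_iff parcs_cycle_graph_ends irrefl_def sym_def path_arcs_commute
        dest: path_arcsD)
qed

text \<open>Every vertex has a successor along the cycle. A cycle is thus determined by its arcs, in
  agreement with the vertex set that \<open>ring_sum\<close> assigns.\<close>

lemma Field_parcs_cycle:
  assumes "is_cycle C"
  shows "Field (parcs C) = pverts C"
proof
  show "Field (parcs C) \<subseteq> pverts C"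
    using pair_graph_cycle[OF assms] by (auto simp: pair_graph_iff Field_def)
  obtain xs where xs: "3 \<le> length xs" "C = cycle_graph xs"
    using assms by (auto simp: is_cycle_def)
  have "pverts C = Domain (set (zip xs (rotate1 xs)))"
    using xs by (simp add: Domain_fst flip: set_map)
  then show "pverts C \<subseteq> Field (parcs C)"
    using xs by (auto simp: cycle_graph_def Field_def Let_def)
qed

text \<open>Cut open at an edge \<open>vb\<close>, the cycle is a path from \<open>v\<close> to
  \<open>b\<close>; the other neighbour is the vertex after \<open>v\<close> on this path.\<close>

lemma cycle_vertex_nbrs:
  assumes "is_cycle C" "v \<in> pverts C"
  obtains a b where "a \<noteq> b" "{y. (v, y) \<in> parcs C} = {a, b}"
proof -
  obtain b where b: "(v, b) \<in> parcs C"
    using assms Field_parcs_cycle[OF assms(1)] pair_graph_cycle[OF assms(1)]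
    unfolding Field_def pair_graph_iff by (blast dest: symD)
  then obtain ys where ys: "ys \<noteq> []" "distinct (v # ys @ [b])" "C = cycle_graph (v # ys @ [b])"
    using is_cycle_through_arc[OF assms(1)] by blast
  obtain a zs where "ys = a # zs"
    using ys(1) by (cases ys) auto
  then have "{y. (v, y) \<in> parcs C} = {a, b}"
    using ys parcs_cycle_graph_ends[of v ys b] by (auto dest: path_arcsD)
  then show ?thesis
    using that[of a b] ys \<open>ys = a # zs\<close> by auto
qed

lemma cycle_even_degree: "is_cycle C \<Longrightarrow> even (card {y. (v, y) \<in> parcs C})"
proof (cases "v \<in> pverts C")
  case True
  assume "is_cycle C"
  then obtain a b where "a \<noteq> b" "{y. (v, y) \<in> parcs C} = {a, b}"
    using True by (rule cycle_vertex_nbrs)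
  then show ?thesis by simp
next
  case False
  moreover assume "is_cycle C"
  ultimately have "{y. (v, y) \<in> parcs C} = {}"
    using pair_graph_cycle by (auto simp: pair_graph_iff)
  then show ?thesis by (metis card.empty even_zero)
qed

lemma eulerian_cycle:
  assumes "is_cycle C"
  shows "eulerian C"
  unfolding eulerian_def
proof
  fix v
  have "out_arcs (with_proj C) v = Pair v ` {y. (v, y) \<in> parcs C}"
    by (auto simp: out_arcs_def)
  then have "out_degree (with_proj C) v = card {y. (v, y) \<in> parcs C}"
    by (simp add: out_degree_def card_image inj_on_def)
  then show "even (out_degree (with_proj C) v)"
    using cycle_even_degree[OF assms] by simp
qed

lemma induced_cycle_iff:
  assumes "pair_graph G"
  shows "induced_cycle G C \<longleftrightarrow> is_cycle C \<and> pverts C \<subseteq> pverts G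
    \<and> parcs C = parcs G \<inter> pverts C \<times> pverts C"
  using assms
  by (fastforce simp: induced_cycle_def induced_subgraph_def subgraph_with_proj_iff pair_graph_iff)

section \<open>Ear constructions\<close>

definition add_ear :: "'a pair_pre_digraph \<Rightarrow> 'a \<Rightarrow> 'a list \<Rightarrow> 'a \<Rightarrow> 'a pair_pre_digraph" where
  "add_ear G u ys v = graph_union G (path_graph (u # ys @ [v]))"

text \<open>The list \<open>ys\<close> holds the inner vertices only; its being nonempty stands for
  the bound on the number of edges in \<open>add_path\<close>.\<close>

definition is_ear :: "'a pair_pre_digraph \<Rightarrow> 'a \<Rightarrow> 'a list \<Rightarrow> 'a \<Rightarrow> bool" where
  "is_ear G u ys v \<longleftrightarrow> (u, v) \<in> parcs G \<and> ys \<noteq> [] \<and> distinct ys \<and> set ys \<inter> pverts G = {}"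

text \<open>
  Starting from a single edge instead of a cycle makes all base cases trivial: a cycle is an
  edge with one ear.
\<close>

inductive ear_tree :: "'a pair_pre_digraph \<Rightarrow> bool" where
  edge: "u \<noteq> v \<Longrightarrow> ear_tree (path_graph [u, v])"
| ear: "\<lbrakk>ear_tree G; is_ear G u ys v\<rbrakk> \<Longrightarrow> ear_tree (add_ear G u ys v)"

lemma parcs_add_ear [simp]: "parcs (add_ear G u ys v) = parcs G \<union> path_arcs (u # ys @ [v])"
  by (simp add: add_ear_def graph_union_def)

lemma is_earD:
  assumes "pair_graph G" "is_ear G u ys v"
  shows "(u, v) \<in> parcs G" "(v, u) \<in> parcs G" "ys \<noteq> []" "set ys \<inter> pverts G = {}"
    "u \<in> pverts G" "v \<in> pverts G" "distinct (u # ys @ [v])"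
proof -
  show "(u, v) \<in> parcs G" "ys \<noteq> []" "set ys \<inter> pverts G = {}"
    using assms(2) by (simp_all add: is_ear_def)
  then show "(v, u) \<in> parcs G" "u \<in> pverts G" "v \<in> pverts G"
    using assms(1) unfolding pair_graph_iff by (blast dest: symD)+
  then show "distinct (u # ys @ [v])"
    using assms by (auto simp: is_ear_def pair_graph_iff irrefl_def)
qed

lemma pverts_add_ear:
  assumes "pair_graph G" "is_ear G u ys v"
  shows "pverts (add_ear G u ys v) = pverts G \<union> set ys"
  using is_earD[OF assms] by (auto simp: add_ear_def graph_union_def)

lemma pair_graph_add_ear:
  assumes "pair_graph G" "is_ear G u ys v"
  shows "pair_graph (add_ear G u ys v)"
proof -
  have "path_arcs (u # ys @ [v]) \<subseteq> (pverts G \<union> set ys) \<times> (pverts G \<union> set ys)"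
    using path_arcs_subset[of "u # ys @ [v]"] is_earD(5,6)[OF assms] by auto
  moreover have "irrefl (path_arcs (u # ys @ [v]))"
    by (rule irrefl_path_arcs[OF is_earD(7)[OF assms]])
  ultimately show ?thesis
    using assms(1) sym_path_arcs[of "u # ys @ [v]"]
    unfolding pair_graph_iff pverts_add_ear[OF assms] parcs_add_ear irrefl_def
    by (blast intro: sym_Un)
qed

lemma ear_arcs_outside:
  assumes "pair_graph G" "is_ear G u ys v"
  shows "path_arcs (u # ys @ [v]) \<inter> pverts G \<times> pverts G = {}"
  using is_earD[OF assms] path_arcs_inner[of _ _ u ys v] by blast

lemma pair_graph_ear_tree: "ear_tree G \<Longrightarrow> pair_graph G"
proof (induction rule: ear_tree.induct)
  case (edge u v)
  then show ?case
    by (auto simp: pair_graph_iff sym_def irrefl_def)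
next
  case (ear G u ys v)
  then show ?case
    by (intro pair_graph_add_ear)
qed

section \<open>Ear trees and polygonal 2-trees\<close>

lemma add_ear_edge_eq_cycle: "add_ear (path_graph [a, b]) a ys b = cycle_graph (a # ys @ [b])"
  by (rule pair_pre_digraph.equality)
    (auto simp: add_ear_def graph_union_def parcs_cycle_graph_ends)

lemma is_ear_edge: "is_ear (path_graph [a, b]) a ys b \<longleftrightarrow> ys \<noteq> [] \<and> distinct ys \<and> a \<notin> set ys \<and> b \<notin> set ys"
  by (auto simp: is_ear_def)

lemma ear_tree_cycle:
  assumes "is_cycle C"
  shows "ear_tree C"
proof -
  obtain a b ys where C: "ys \<noteq> []" "distinct (a # ys @ [b])" "C = cycle_graph (a # ys @ [b])"
    using assms by (rule is_cycle_form)
  then have "ear_tree (add_ear (path_graph [a, b]) a ys b)"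
    by (intro ear_tree.intros) (auto simp: is_ear_edge)
  then show ?thesis
    using C by (simp add: add_ear_edge_eq_cycle)
qed

text \<open>Stripping the two ends from the list behind \<open>is_path\<close> gives an ear,
  nonempty because \<open>P\<close> has at least two edges. The cardinality is carried along because
  \<open>ear_tree\<close> also admits a single edge.\<close>

lemma ear_tree_if_polygonal_2_tree: "polygonal_2_tree G \<Longrightarrow> ear_tree G \<and> 3 \<le> card (pverts G)"
proof (induction rule: polygonal_2_tree.induct)
  case (cycle C)
  then show ?case
    by (auto simp: ear_tree_cycle is_cycle_def distinct_card)
next
  case (add_path G u v P)
  then have G: "pair_graph G"
    using pair_graph_ear_tree by blast
  have uv: "(u, v) \<in> parcs G" "u \<noteq> v"
    using add_path.hyps(2) G by (auto simp: doubleton_in_uedges_iff pair_graph_iff irrefl_def)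
  obtain xs where xs: "xs \<noteq> []" "distinct xs" "hd xs = u" "last xs = v" "P = path_graph xs"
    using add_path by (auto simp: is_path_def)
  obtain t where t: "xs = u # t" "t \<noteq> []"
    using xs uv by (cases xs) (auto split: if_splits)
  obtain ys where ys: "xs = u # ys @ [v]"
    using t xs(4) by (metis append_butlast_last_id last_ConsR)
  have "ys \<noteq> []"
  proof
    assume "ys = []"
    then have "uedges P = {{u, v}}"
      using xs ys by (auto simp: uedges_def)
    then show False
      using add_path by simp
  qed
  moreover have "set ys \<inter> pverts G = {}"
    using \<open>pverts G \<inter> pverts P = {u, v}\<close> xs ys by auto
  ultimately have ear: "is_ear G u ys v"
    using uv xs ys by (auto simp: is_ear_def)
  then have "card (pverts G) \<le> card (pverts (add_ear G u ys v))"
    using G by (auto simp: pverts_add_ear pair_graph_iff intro!: card_mono)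
  then show ?case
    using ear_tree.ear[OF _ ear] add_path xs ys by (simp add: add_ear_def)
qed

lemma polygonal_2_tree_add_ear:
  assumes "polygonal_2_tree G" "pair_graph G" "is_ear G u ys v"
  shows "polygonal_2_tree (add_ear G u ys v)"
  unfolding add_ear_def
proof (rule polygonal_2_tree.add_path[OF assms(1)])
  note ear = is_earD[OF assms(2,3)]
  let ?P = "path_graph (u # ys @ [v])"
  show "{u, v} \<in> uedges G"
    using ear by (auto simp: uedges_def)
  show "is_path u ?P v"
    using ear unfolding is_path_def by (intro exI[of _ "u # ys @ [v]"]) auto
  show "pverts G \<inter> pverts ?P = {u, v}"
    using ear by auto
  show "uedges G \<inter> uedges ?P = {}"
    using ear path_arcs_inner[of _ _ u ys v] assms(2)
    by (fastforce simp: uedges_def doubleton_eq_iff pair_graph_iff)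
  \<comment> \<open>The first and the last edge of the ear differ even if there is only one inner
    vertex, as \<open>u\<close> and \<open>v\<close> are distinct.\<close>
  have "{{u, hd ys}, {last ys, v}} \<subseteq> uedges ?P"
    using path_arcs_ends[OF ear(3)] by (simp add: doubleton_in_uedges_iff sym_path_arcs)
  moreover have "{u, hd ys} \<noteq> {last ys, v}"
    using ear(3,7) hd_in_set[OF ear(3)] last_in_set[OF ear(3)] by (auto simp: doubleton_eq_iff)
  moreover have "finite (uedges ?P)"
  proof -
    have "uedges ?P = (\<lambda>(x, y). {x, y}) ` path_arcs (u # ys @ [v])"
      unfolding uedges_def parcs_path_graph by auto
    moreover have "finite (path_arcs (u # ys @ [v]))"
      by (rule finite_subset[OF path_arcs_subset]) simp
    ultimately show ?thesis by simp
  qed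
  ultimately show "2 \<le> card (uedges ?P)"
    by (metis card_2_iff card_mono)
qed

text \<open>Recognises the stage at which an ear tree is still its initial edge: the ends of
  \<open>uv\<close> already use up all vertices.\<close>

lemma pair_graph_eq_edge:
  assumes "pair_graph G" "(u, v) \<in> parcs G" "card (pverts G) < 3"
  shows "G = path_graph [u, v]"
proof -
  have uv: "(v, u) \<in> parcs G" "u \<in> pverts G" "v \<in> pverts G" "u \<noteq> v"
    using assms(1,2) unfolding pair_graph_iff irrefl_def by (blast dest: symD)+
  then have V: "{u, v} = pverts G"
    using assms(1,3) by (intro card_seteq) (simp_all add: pair_graph_iff)
  then have "parcs G \<subseteq> {(u, v), (v, u)}"
    using assms(1) unfolding pair_graph_iff irrefl_def V[symmetric] by blast
  then show ?thesis
    using V uv(1) assms(2) by (intro pair_pre_digraph.equality) auto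
qed

lemma card_ge_3_if_two_edges:
  assumes "pair_graph G" "(a, b) \<in> parcs G" "(a, b) \<noteq> (u, v)" "(a, b) \<noteq> (v, u)"
    "(u, v) \<in> parcs G"
  shows "3 \<le> card (pverts G)"
proof (rule ccontr)
  assume "\<not> 3 \<le> card (pverts G)"
  then have "G = path_graph [u, v]"
    using assms(1,5) by (intro pair_graph_eq_edge) simp_all
  then have "parcs G = {(u, v), (v, u)}"
    by simp
  then show False
    using assms(2-4) by auto
qed

text \<open>The first ear turns the initial edge into a cycle, the base case of
  \<open>polygonal_2_tree\<close>; every later ear is an instance of
  \<open>add_path\<close>.\<close>

lemma polygonal_2_tree_if_ear_tree: "ear_tree G \<Longrightarrow> 3 \<le> card (pverts G) \<Longrightarrow> polygonal_2_tree G"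
proof (induction rule: ear_tree.induct)
  case (edge u v)
  then show ?case by simp
next
  case (ear G u ys v)
  have G: "pair_graph G"
    using ear pair_graph_ear_tree by blast
  note e = is_earD[OF G \<open>is_ear G u ys v\<close>]
  show ?case
  proof (cases "3 \<le> card (pverts G)")
    case True
    then show ?thesis
      using ear.IH ear.hyps(2) by (intro polygonal_2_tree_add_ear G)
  next
    case False
    then have "G = path_graph [u, v]"
      using G e(1) by (intro pair_graph_eq_edge) simp_all
    moreover have "is_cycle (cycle_graph (u # ys @ [v]))"
      using e(3,7) by (intro is_cycleI)
    ultimately show ?thesis
      by (simp only: add_ear_edge_eq_cycle polygonal_2_tree.cycle)
  qed
qed

section \<open>Connectivity\<close>

definition avoiding :: "'a rel \<Rightarrow> 'a \<Rightarrow> 'a rel" where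
  "avoiding A c = {(x, y) \<in> A. x \<noteq> c \<and> y \<noteq> c}"

text \<open>
  The vertex \<open>c\<close> need not belong to \<open>G\<close>, so that deleting nothing is covered as well.
\<close>

definition no_cut_vertex :: "'a pair_pre_digraph \<Rightarrow> bool" where
  "no_cut_vertex G \<longleftrightarrow> (\<forall>c. \<forall>x \<in> pverts G - {c}. \<forall>y \<in> pverts G - {c}.
     (x, y) \<in> (avoiding (parcs G) c)\<^sup>*)"

lemma sym_avoiding: "sym A \<Longrightarrow> sym (avoiding A c)"
  by (auto simp: avoiding_def sym_def)

lemma avoiding_mono: "A \<subseteq> B \<Longrightarrow> avoiding A c \<subseteq> avoiding B c"
  by (auto simp: avoiding_def)

lemma strongly_connected_with_proj_iff:
  assumes "parcs G \<subseteq> pverts G \<times> pverts G"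
  shows "strongly_connected (with_proj G) \<longleftrightarrow>
    pverts G \<noteq> {} \<and> (\<forall>x \<in> pverts G. \<forall>y \<in> pverts G. (x, y) \<in> (parcs G)\<^sup>*)"
proof -
  interpret pair_wf_digraph G
    using assms by (simp add: pair_wf_digraph_iff)
  show ?thesis
    by (auto simp: strongly_connected_def reachable_conv)
qed

lemma connected_iff:
  assumes "parcs G \<subseteq> pverts G \<times> pverts G" "sym (parcs G)"
  shows "connected (with_proj G) \<longleftrightarrow>
    pverts G \<noteq> {} \<and> (\<forall>x \<in> pverts G. \<forall>y \<in> pverts G. (x, y) \<in> (parcs G)\<^sup>*)"
proof -
  have "mk_symmetric (with_proj G) = G"
    using assms(2) by (intro pair_pre_digraph.equality) (auto simp: mk_symmetric_def dest: symD)
  then show ?thesis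
    using strongly_connected_with_proj_iff[OF assms(1)] by (simp add: connected_def)
qed

lemma connected_del_vert_iff:
  assumes "pair_graph G"
  shows "connected (pre_digraph.del_vert (with_proj G) c) \<longleftrightarrow> pverts G - {c} \<noteq> {} \<and>
    (\<forall>x \<in> pverts G - {c}. \<forall>y \<in> pverts G - {c}. (x, y) \<in> (avoiding (parcs G) c)\<^sup>*)"
proof -
  let ?H = "\<lparr>pverts = pverts G - {c}, parcs = avoiding (parcs G) c\<rparr>"
  have "pre_digraph.del_vert (with_proj G) c = with_proj ?H"
    by (auto simp: pre_digraph.del_vert_def with_proj_def avoiding_def)
  moreover have "parcs ?H \<subseteq> pverts ?H \<times> pverts ?H" "sym (parcs ?H)"
    using assms sym_avoiding by (auto simp: pair_graph_iff avoiding_def sym_def)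
  ultimately show ?thesis
    using connected_iff[of ?H] by simp
qed

text \<open>Two vertices of the whole graph are connected because they remain so after deletion of a
  third one. Conversely, a \<open>c\<close> outside the graph deletes nothing, and plain
  connectedness applies.\<close>

lemma two_connected_iff:
  assumes "pair_graph G"
  shows "two_connected G \<longleftrightarrow> 3 \<le> card (pverts G) \<and> no_cut_vertex G"
proof
  assume G: "3 \<le> card (pverts G) \<and> no_cut_vertex G"
  have "(x, y) \<in> (parcs G)\<^sup>*" if xy: "x \<in> pverts G" "y \<in> pverts G" for x y
  proof -
    have "\<not> pverts G \<subseteq> {x, y}"
      using G card_mono[of "{x, y}" "pverts G"] by (auto simp: card_insert_if split: if_splits)
    then obtain c where "c \<in> pverts G" "c \<noteq> x" "c \<noteq> y"
      by blast
    then have "(x, y) \<in> (avoiding (parcs G) c)\<^sup>*"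
      using G xy by (auto simp: no_cut_vertex_def)
    moreover have "avoiding (parcs G) c \<subseteq> parcs G"
      by (auto simp: avoiding_def)
    ultimately show ?thesis
      using rtrancl_mono by blast
  qed
  moreover have "pverts G - {c} \<noteq> {}" for c
    using G card_mono[of "{c}" "pverts G"] by auto
  ultimately show "two_connected G"
    using G assms unfolding two_connected_def
    by (auto simp: connected_iff connected_del_vert_iff pair_graph_iff no_cut_vertex_def)
next
  assume G: "two_connected G"
  have "(x, y) \<in> (avoiding (parcs G) c)\<^sup>*" if xy: "x \<in> pverts G - {c}" "y \<in> pverts G - {c}"
    for x y c
  proof (cases "c \<in> pverts G")
    case True
    then show ?thesis
      using G xy assms by (auto simp: two_connected_def connected_del_vert_iff)
  next
    case False
    then have "avoiding (parcs G) c = parcs G"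
      using assms by (auto simp: avoiding_def pair_graph_iff)
    moreover have "(x, y) \<in> (parcs G)\<^sup>*"
      using G xy assms by (auto simp: two_connected_def connected_iff pair_graph_iff)
    ultimately show ?thesis
      by simp
  qed
  then show "3 \<le> card (pverts G) \<and> no_cut_vertex G"
    using G by (simp add: no_cut_vertex_def two_connected_def)
qed

lemma path_reaches_hd: "x \<in> set xs \<Longrightarrow> (x, hd xs) \<in> (path_arcs xs)\<^sup>*"
proof (induction xs rule: path_arcs.induct)
  case (1 y z zs)
  show ?case
  proof (cases "x = y")
    case False
    then have "(x, z) \<in> (path_arcs (z # zs))\<^sup>*"
      using 1 by simp
    then have "(x, z) \<in> (path_arcs (y # z # zs))\<^sup>*"
      by (rule rtrancl_mono[THEN subsetD, rotated]) auto
    then show ?thesis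
      by (rule rtrancl_into_rtrancl) simp
  qed simp
qed auto

lemma path_reaches_last: "x \<in> set xs \<Longrightarrow> (x, last xs) \<in> (path_arcs xs)\<^sup>*"
  using path_reaches_hd[of x "rev xs"] by (simp add: path_arcs_rev hd_rev)

lemma path_arcs_append_subset: "path_arcs ps \<subseteq> path_arcs (ps @ qs)" "path_arcs qs \<subseteq> path_arcs (ps @ qs)"
proof -
  show 1: "path_arcs qs \<subseteq> path_arcs (ps @ qs)" for ps qs :: "'a list"
    by (cases qs) (use path_arcs_append in fastforce)+
  show "path_arcs ps \<subseteq> path_arcs (ps @ qs)"
    using 1[of "rev ps" "rev qs"] path_arcs_rev[of ps] path_arcs_rev[of "ps @ qs"] by simp
qed

text \<open>Deleting \<open>c\<close> leaves at most two pieces of the path, and each nonempty piece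
  contains an end.\<close>

lemma path_avoiding_reaches_end:
  assumes "distinct xs" "x \<in> set xs" "x \<noteq> c"
  shows "(x, hd xs) \<in> (avoiding (path_arcs xs) c)\<^sup>* \<or> (x, last xs) \<in> (avoiding (path_arcs xs) c)\<^sup>*"
proof (cases "c \<in> set xs")
  case False
  then have "avoiding (path_arcs xs) c = path_arcs xs"
    by (auto simp: avoiding_def dest: path_arcsD)
  then show ?thesis
    using path_reaches_hd[OF assms(2)] by simp
next
  case True
  then obtain ps qs where xs: "xs = ps @ c # qs"
    by (meson split_list)
  have "path_arcs ps \<subseteq> avoiding (path_arcs xs) c" "path_arcs qs \<subseteq> avoiding (path_arcs xs) c"
    using assms(1) path_arcs_append_subset[of ps "c # qs"] path_arcs_append_subset(2)[of qs "ps @ [c]"]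
    by (auto simp: xs avoiding_def dest: path_arcsD)
  then have "(path_arcs ps)\<^sup>* \<subseteq> (avoiding (path_arcs xs) c)\<^sup>*"
    "(path_arcs qs)\<^sup>* \<subseteq> (avoiding (path_arcs xs) c)\<^sup>*"
    by (simp_all add: rtrancl_mono)
  moreover have "(x, hd xs) \<in> (path_arcs ps)\<^sup>*" if "x \<in> set ps"
    using path_reaches_hd[OF that] that by (cases ps) (simp_all add: xs)
  moreover have "(x, last xs) \<in> (path_arcs qs)\<^sup>*" if "x \<in> set qs"
    using path_reaches_last[OF that] that by (cases "qs = []") (simp_all add: xs)
  moreover have "x \<in> set ps \<or> x \<in> set qs"
    using assms xs by simp
  ultimately show ?thesis
    by blast
qed

text \<open>From any vertex of the ear one can walk along it to an end in \<open>G\<close> without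
  meeting \<open>c\<close>; within \<open>G\<close> the induction hypothesis connects the ends
  reached.\<close>

lemma no_cut_vertex_ear_tree: "ear_tree G \<Longrightarrow> no_cut_vertex G"
proof (induction rule: ear_tree.induct)
  case (edge u v)
  show ?case
    by (auto simp: no_cut_vertex_def avoiding_def intro: r_into_rtrancl)
next
  case (ear G u ys v)
  have G: "pair_graph G"
    using ear pair_graph_ear_tree by blast
  note e = is_earD[OF G \<open>is_ear G u ys v\<close>]
  have symH: "sym (parcs (add_ear G u ys v))"
    using pair_graph_add_ear[OF G \<open>is_ear G u ys v\<close>] by (simp only: pair_graph_iff)
  have "(x, y) \<in> (avoiding (parcs (add_ear G u ys v)) c)\<^sup>*"
    if xy: "x \<in> pverts G \<union> set ys" "y \<in> pverts G \<union> set ys" "x \<noteq> c" "y \<noteq> c" for c x y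
  proof -
    let ?R = "(avoiding (parcs (add_ear G u ys v)) c)\<^sup>*"
    have sub: "(avoiding (parcs G) c)\<^sup>* \<subseteq> ?R" "(avoiding (path_arcs (u # ys @ [v])) c)\<^sup>* \<subseteq> ?R"
      by (intro rtrancl_mono avoiding_mono; simp)+
    \<comment> \<open>The end that is reached must itself differ from \<open>c\<close>: arcs of
      \<open>avoiding\<close> never enter \<open>c\<close>, and the walk starts elsewhere.\<close>
    have not_c: "t \<noteq> c" if "(s, t) \<in> (avoiding B c)\<^sup>*" "s \<noteq> c" for B s t
      using that by (induction rule: rtrancl_induct) (auto simp: avoiding_def)
    have reach: "\<exists>t \<in> pverts G - {c}. (s, t) \<in> ?R" if "s \<in> pverts G \<union> set ys" "s \<noteq> c" for s
    proof (cases "s \<in> pverts G")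
      case False
      then have "s \<in> set (u # ys @ [v])"
        using that by simp
      from path_avoiding_reaches_end[OF e(7) this that(2)]
      obtain t where "t \<in> {u, v}" "(s, t) \<in> (avoiding (path_arcs (u # ys @ [v])) c)\<^sup>*"
        by auto
      then show ?thesis
        using not_c that(2) sub e by blast
    qed (use that in auto)
    obtain x' where x': "x' \<in> pverts G - {c}" "(x, x') \<in> ?R"
      using reach xy by blast
    obtain y' where y': "y' \<in> pverts G - {c}" "(y, y') \<in> ?R"
      using reach xy by blast
    have "(x', y') \<in> ?R"
      using ear.IH x' y' sub by (auto simp: no_cut_vertex_def)
    moreover have "(y', y) \<in> ?R"
      using y' sym_rtrancl[OF sym_avoiding[OF symH]] by (blast dest: symD)
    ultimately show ?thesis
      using x' by (meson rtrancl_trans)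
  qed
  then show ?case
    unfolding no_cut_vertex_def pverts_add_ear[OF G \<open>is_ear G u ys v\<close>] by blast
qed

section \<open>Embeddings into 2-trees\<close>

text \<open>An isomorphism onto a subgraph, written as an injective homomorphism so that the
  intermediate copy needs no name.\<close>

definition embeds :: "('a \<Rightarrow> 'b) \<Rightarrow> 'a pair_pre_digraph \<Rightarrow> 'b pair_pre_digraph \<Rightarrow> bool" where
  "embeds f G T \<longleftrightarrow> inj_on f (pverts G) \<and> f ` pverts G \<subseteq> pverts T
     \<and> (\<forall>(x, y) \<in> parcs G. (f x, f y) \<in> parcs T)"

lemma pair_graph_two_tree: "two_tree T \<Longrightarrow> pair_graph T"
proof (induction rule: two_tree.induct)
  case (triangle x y z)
  then have "is_cycle (cycle_graph [x, y, z])"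
    by (auto simp: is_cycle_def intro!: exI[of _ "[x, y, z]"])
  then show ?case
    by (rule pair_graph_cycle)
next
  case (add_vertex T u v w)
  then have "(u, v) \<in> parcs T"
    by (simp add: doubleton_in_uedges_iff pair_graph_iff)
  with add_vertex show ?case
    unfolding pair_graph_iff by (auto simp: irrefl_def sym_def)
qed

lemma partial_2_tree_iff:
  fixes G :: "'a pair_pre_digraph"
  assumes "pair_graph G"
  shows "partial_2_tree G \<longleftrightarrow> (\<exists>(f :: 'a \<Rightarrow> nat) T. two_tree T \<and> embeds f G T)"
proof
  assume "partial_2_tree G"
  then obtain H T :: "nat pair_pre_digraph" where
    H: "digraph_iso (with_proj G) (with_proj H)" "subgraph (with_proj H) (with_proj T)" "two_tree T"
    by (auto simp: partial_2_tree_def)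
  obtain h where h: "pre_digraph.digraph_isomorphism (with_proj G) h"
    "with_proj H = app_iso h (with_proj G)"
    using H(1) by (auto simp: digraph_iso_def)
  have "iso_head h = snd" "iso_tail h = fst"
    "pverts H = iso_verts h ` pverts G" "parcs H = iso_arcs h ` parcs G"
    using h(2) by (simp_all add: with_proj_def app_iso_def)
  \<comment> \<open>An isomorphism carries separate maps for vertices and arcs; compatibility with
    heads and tails forces the arc map to act componentwise.\<close>
  moreover from this have "iso_arcs h (x, y) = (iso_verts h x, iso_verts h y)"
    if "(x, y) \<in> parcs G" for x y
    using h(1) that by (auto simp: pre_digraph.digraph_isomorphism_def prod_eq_iff)
  ultimately have "embeds (iso_verts h) G T"
    using h(1) H(2)
    unfolding embeds_def subgraph_with_proj_iff pre_digraph.digraph_isomorphism_def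
    by (auto dest!: subsetD)
  then show "\<exists>(f :: 'a \<Rightarrow> nat) T. two_tree T \<and> embeds f G T"
    using H(3) by blast
next
  assume "\<exists>(f :: 'a \<Rightarrow> nat) T. two_tree T \<and> embeds f G T"
  then obtain f :: "'a \<Rightarrow> nat" and T where T: "two_tree T" "embeds f G T"
    by blast
  let ?h = "\<lparr>iso_verts = f, iso_arcs = map_prod f f, iso_head = snd, iso_tail = fst\<rparr>"
  let ?H = "\<lparr>pverts = f ` pverts G, parcs = map_prod f f ` parcs G\<rparr>"
  have G: "parcs G \<subseteq> pverts G \<times> pverts G"
    using assms by (simp add: pair_graph_iff)
  have inj: "inj_on f (pverts G)"
    using T by (simp add: embeds_def)
  have "inj_on (map_prod f f) (parcs G)"
    using map_prod_inj_on[OF inj inj] G by (rule inj_on_subset)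
  moreover have "wf_digraph (with_proj G)"
    using G by (simp add: wf_digraph_wp_iff pair_wf_digraph_iff)
  ultimately have "pre_digraph.digraph_isomorphism (with_proj G) ?h"
    using inj by (auto simp: pre_digraph.digraph_isomorphism_def)
  moreover have "with_proj ?H = app_iso ?h (with_proj G)"
    by (simp add: app_iso_def with_proj_def)
  ultimately have "digraph_iso (with_proj G) (with_proj ?H)"
    unfolding digraph_iso_def by blast
  moreover have "subgraph (with_proj ?H) (with_proj T)"
    using T pair_graph_two_tree[OF T(1)] G
    by (auto simp: subgraph_with_proj_iff embeds_def pair_graph_iff)
  ultimately show "partial_2_tree G"
    using T(1) unfolding partial_2_tree_def by blast
qed

lemma embeds_mono:
  "embeds f H T \<Longrightarrow> pverts G \<subseteq> pverts H \<Longrightarrow> parcs G \<subseteq> parcs H \<Longrightarrow> embeds f G T"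
  by (auto simp: embeds_def inj_on_subset)

text \<open>The new vertices of an ear form a fan: each is attached to its predecessor and to \<open>v\<close>.\<close>

lemma embeds_add_fan:
  fixes f :: "'a \<Rightarrow> nat"
  assumes "two_tree T" "embeds f G T" "parcs G \<subseteq> pverts G \<times> pverts G" "(u, v) \<in> parcs G"
    "distinct ys" "set ys \<inter> pverts G = {}"
  shows "\<exists>(f' :: 'a \<Rightarrow> nat) T'. two_tree T' \<and>
    embeds f' \<lparr>pverts = pverts G \<union> set ys, parcs = parcs G \<union> path_arcs (u # ys @ [v])\<rparr> T'"
  using assms
proof (induction ys arbitrary: f G T u)
  case Nil
  \<comment> \<open>With no inner vertex left, the path from \<open>u\<close> to \<open>v\<close> is
    the edge \<open>uv\<close>, which \<open>T\<close> already contains.\<close>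
  have "(f u, f v) \<in> parcs T"
    using Nil by (auto simp: embeds_def)
  moreover from this have "(f v, f u) \<in> parcs T"
    using pair_graph_two_tree[OF Nil(1)] unfolding pair_graph_iff by (blast dest: symD)
  ultimately have "embeds f \<lparr>pverts = pverts G \<union> set [], parcs = parcs G \<union> path_arcs (u # [] @ [v])\<rparr> T"
    using Nil(2) by (auto simp: embeds_def)
  then show ?case
    using Nil(1) by blast
next
  case (Cons y ys)
  have T: "pair_graph T"
    using Cons.prems(1) by (rule pair_graph_two_tree)
  then obtain w where w: "w \<notin> pverts T"
    using ex_new_if_finite[OF infinite_UNIV_nat] by (auto simp: pair_graph_iff)
  \<comment> \<open>The auxiliary edge \<open>yv\<close> is the one over which the rest of the ear
    is attached; \<open>embeds_mono\<close> drops it at the end.\<close>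
  let ?G = "\<lparr>pverts = insert y (pverts G),
    parcs = parcs G \<union> {(u, y), (y, u), (v, y), (y, v)}\<rparr>"
  let ?T = "\<lparr>pverts = insert w (pverts T),
    parcs = parcs T \<union> {(f u, w), (w, f u), (f v, w), (w, f v)}\<rparr>"
  have y: "y \<notin> pverts G" and uv: "u \<in> pverts G" "v \<in> pverts G"
    using Cons.prems by auto
  have "(f u, f v) \<in> parcs T"
    using Cons.prems by (auto simp: embeds_def)
  then have "two_tree ?T"
    using Cons.prems(1) w by (intro two_tree.add_vertex) (auto simp: uedges_def)
  moreover have "embeds (f(y := w)) ?G ?T"
  proof -
    have "inj_on (f(y := w)) (pverts ?G)"
      using Cons.prems(2) w y by (auto simp: embeds_def inj_on_def)
    moreover have "(x \<noteq> y \<and> z \<noteq> y)" if "(x, z) \<in> parcs G" for x z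
      using that Cons.prems(3) y by blast
    ultimately show ?thesis
      using Cons.prems(2) y uv by (auto simp: embeds_def)
  qed
  ultimately have "\<exists>(f' :: 'a \<Rightarrow> nat) T'. two_tree T' \<and>
    embeds f' \<lparr>pverts = pverts ?G \<union> set ys, parcs = parcs ?G \<union> path_arcs (y # ys @ [v])\<rparr> T'"
    using Cons.prems uv by (intro Cons.IH) auto
  then obtain f' :: "'a \<Rightarrow> nat" and T' where T': "two_tree T'"
    "embeds f' \<lparr>pverts = pverts ?G \<union> set ys, parcs = parcs ?G \<union> path_arcs (y # ys @ [v])\<rparr> T'"
    by blast
  have "embeds f' \<lparr>pverts = pverts G \<union> set (y # ys),
      parcs = parcs G \<union> path_arcs (u # (y # ys) @ [v])\<rparr> T'"
    using T'(2) by (rule embeds_mono) auto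
  then show ?case
    using T'(1) by blast
qed

lemma partial_2_tree_ear_tree:
  fixes G :: "'a pair_pre_digraph"
  assumes "ear_tree G"
  shows "partial_2_tree G"
proof -
  have "\<exists>(f :: 'a \<Rightarrow> nat) T. two_tree T \<and> embeds f G T"
    using assms
  proof (induction rule: ear_tree.induct)
    case (edge u v)
    have "two_tree (cycle_graph [0, 1, 2 :: nat])"
      by (rule two_tree.triangle) simp
    moreover have "embeds (\<lambda>x. if x = u then 0 else 1) (path_graph [u, v]) (cycle_graph [0, 1, 2 :: nat])"
      using edge by (auto simp: embeds_def inj_on_def parcs_cycle_graph)
    ultimately show ?case
      by blast
  next
    case (ear G u ys v)
    then obtain f :: "'a \<Rightarrow> nat" and T where T: "two_tree T" "embeds f G T"
      by blast
    have G: "pair_graph G"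
      using ear.hyps(1) by (rule pair_graph_ear_tree)
    have "add_ear G u ys v
      = \<lparr>pverts = pverts G \<union> set ys, parcs = parcs G \<union> path_arcs (u # ys @ [v])\<rparr>"
      by (rule pair_pre_digraph.equality) (simp_all add: pverts_add_ear[OF G ear.hyps(2)])
    then show ?case
      using embeds_add_fan[OF T, of u v ys] G ear.hyps(2) by (simp add: is_ear_def pair_graph_iff)
  qed
  then show ?thesis
    using partial_2_tree_iff[OF pair_graph_ear_tree[OF assms]] by blast
qed

text \<open>Undo the construction of the 2-tree until the vertex removed is the image of some
  \<open>w\<close>. All neighbours of \<open>w\<close> are then mapped to the two ends of an edge
  \<open>pq\<close> of the remaining 2-tree, so an edge joining two such neighbours can be added to
  the rest of \<open>G\<close> without leaving \<open>T'\<close>. With four vertices in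
  \<open>G\<close> this happens before only the triangle is left.\<close>

lemma embeds_elimination_vertex:
  assumes "two_tree T" "embeds f G T" "pair_graph G" "4 \<le> card (pverts G)"
  shows "\<exists>w \<in> pverts G. \<exists>T' p q. two_tree T' \<and> (p, q) \<in> parcs T'
    \<and> f ` (pverts G - {w}) \<subseteq> pverts T'
    \<and> (\<forall>(x, y) \<in> avoiding (parcs G) w. (f x, f y) \<in> parcs T')
    \<and> (\<forall>y. (w, y) \<in> parcs G \<longrightarrow> f y = p \<or> f y = q)"
  using assms
proof (induction rule: two_tree.induct)
  case (triangle x y z)
  then have "card (f ` pverts G) \<le> card (set [x, y, z])"
    by (intro card_mono) (auto simp: embeds_def)
  also have "\<dots> \<le> 3"
    using card_length[of "[x, y, z]"] by simp
  finally show ?case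
    using triangle by (simp add: embeds_def card_image)
next
  case (add_vertex T u v t)
  have T: "pair_graph T"
    using add_vertex.hyps(1) by (rule pair_graph_two_tree)
  let ?T = "\<lparr>pverts = insert t (pverts T), parcs = parcs T \<union> {(u, t), (t, u), (v, t), (t, v)}\<rparr>"
  have uv: "(u, v) \<in> parcs T"
    using add_vertex.hyps(2) T by (simp add: doubleton_in_uedges_iff pair_graph_iff)
  have f: "inj_on f (pverts G)" "f ` pverts G \<subseteq> insert t (pverts T)"
    "\<And>x y. (x, y) \<in> parcs G \<Longrightarrow> (f x, f y) \<in> parcs ?T"
    using add_vertex.prems(1) by (auto simp: embeds_def)
  have notT: "(t, s) \<notin> parcs T" "(s, t) \<notin> parcs T" for s
    using T add_vertex.hyps(3) by (auto simp: pair_graph_iff)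
  show ?case
  proof (cases "t \<in> f ` pverts G")
    case False
    have "(f x, f y) \<in> parcs T" if "(x, y) \<in> parcs G" for x y
    proof -
      have "x \<in> pverts G" "y \<in> pverts G"
        using that add_vertex.prems(2) by (auto simp: pair_graph_iff)
      then show ?thesis
        using f(3)[OF that] False by auto
    qed
    then have "embeds f G T"
      using f False by (auto simp: embeds_def)
    then show ?thesis
      using add_vertex.IH add_vertex.prems by blast
  next
    case True
    then obtain w where w: "w \<in> pverts G" "f w = t"
      by blast
    have not_t: "f x \<noteq> t" if "x \<in> pverts G" "x \<noteq> w" for x
      using f(1) w that by (auto dest: inj_onD)
    have "f ` (pverts G - {w}) \<subseteq> pverts T"
      using f(2) not_t by auto
    moreover have "(f x, f y) \<in> parcs T" if "(x, y) \<in> avoiding (parcs G) w" for x y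
    proof -
      have "(x, y) \<in> parcs G" "x \<noteq> w" "y \<noteq> w" "x \<in> pverts G" "y \<in> pverts G"
        using that add_vertex.prems(2) by (auto simp: avoiding_def pair_graph_iff)
      then show ?thesis
        using f(3)[of x y] not_t[of x] not_t[of y] by simp
    qed
    moreover have "f y = u \<or> f y = v" if "(w, y) \<in> parcs G" for y
      using f(3)[OF that] w notT add_vertex.hyps(3) uv T by (auto simp: pair_graph_iff)
    ultimately show ?thesis
      using add_vertex.hyps(1) uv w(1) by blast
  qed
qed

section \<open>Cycle space\<close>

lemma odd_card_sym_diff:
  assumes "finite A" "finite B"
  shows "odd (card (sym_diff A B)) \<longleftrightarrow> odd (card A) \<noteq> odd (card B)"
proof -
  have "card (sym_diff A B) = card (A - B) + card (B - A)"
    using assms by (intro card_Un_disjoint) auto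
  moreover have "card A = card (A - B) + card (A \<inter> B)" "card B = card (B - A) + card (A \<inter> B)"
    using assms by (subst card_Un_disjoint[symmetric]; fastforce intro: arg_cong[where f = card])+
  ultimately show ?thesis
    by presburger
qed

text \<open>The arcs of \<open>ring_sum\<close> alone. On finite families this is a sum over the
  two-element field, additive in the family by \<open>odd_arcs_sym_diff\<close>.\<close>

definition odd_arcs :: "'a pair_pre_digraph set \<Rightarrow> 'a rel" where
  "odd_arcs S = {a. odd (card {H \<in> S. a \<in> parcs H})}"

lemma ring_sum_eq: "ring_sum S = \<lparr>pverts = Field (odd_arcs S), parcs = odd_arcs S\<rparr>"
  by (simp add: ring_sum_def odd_arcs_def Let_def)

lemma odd_arcs_sym_diff:
  assumes "finite S" "finite S'"
  shows "odd_arcs (sym_diff S S') = sym_diff (odd_arcs S) (odd_arcs S')"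
proof -
  have "{H \<in> sym_diff S S'. a \<in> parcs H} = sym_diff {H \<in> S. a \<in> parcs H} {H \<in> S'. a \<in> parcs H}"
    for a
    by blast
  then have "a \<in> odd_arcs (sym_diff S S') \<longleftrightarrow> (a \<in> odd_arcs S) \<noteq> (a \<in> odd_arcs S')" for a
    using odd_card_sym_diff[of "{H \<in> S. a \<in> parcs H}" "{H \<in> S'. a \<in> parcs H}"] assms
    by (simp add: odd_arcs_def)
  then show ?thesis
    by blast
qed

lemma odd_arcs_singleton [simp]: "odd_arcs {C} = parcs C"
proof -
  have "{H. H = C \<and> a \<in> parcs H} = (if a \<in> parcs C then {C} else {})" for a
    by auto
  then show ?thesis
    by (simp add: odd_arcs_def)
qed

text \<open>On both sides the vertices are exactly the ends of the arcs, so comparing arcs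
  suffices.\<close>

lemma cycle_eq_ring_sum_iff:
  assumes "is_cycle C"
  shows "C = ring_sum S \<longleftrightarrow> parcs C = odd_arcs S"
proof
  assume "parcs C = odd_arcs S"
  then show "C = ring_sum S"
    using Field_parcs_cycle[OF assms] by (intro pair_pre_digraph.equality) (simp_all add: ring_sum_eq)
qed (simp add: ring_sum_eq)

text \<open>An induced cycle is determined by its vertex set, and \<open>G\<close> has finitely many
  of those.\<close>

lemma finite_induced_cycles:
  assumes "pair_graph G"
  shows "finite {C. induced_cycle G C}"
proof (rule finite_imageD)
  have "pverts ` {C. induced_cycle G C} \<subseteq> Pow (pverts G)"
    using assms by (auto simp: induced_cycle_iff)
  then show "finite (pverts ` {C. induced_cycle G C})"
    using assms by (meson finite_Pow_iff finite_subset pair_graph_iff)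
  show "inj_on pverts {C. induced_cycle G C}"
    using assms by (auto simp: induced_cycle_iff inj_on_def intro!: pair_pre_digraph.equality)
qed

lemma parcs_cycle_nonempty: "is_cycle C \<Longrightarrow> parcs C \<noteq> {}"
  by (erule is_cycle_form) (simp add: parcs_cycle_graph_ends)

text \<open>A cycle is an edge with one ear, so the connectivity of ear trees applies.\<close>

lemma cycle_connected:
  assumes "is_cycle C" "x \<in> pverts C" "y \<in> pverts C"
  shows "(x, y) \<in> (parcs C)\<^sup>*"
proof -
  have C: "pair_graph C" "ear_tree C"
    using assms(1) by (simp_all add: pair_graph_cycle ear_tree_cycle)
  moreover have "3 \<le> card (pverts C)"
    using assms(1) by (auto simp: is_cycle_def distinct_card)
  ultimately have "two_connected C"
    by (simp add: two_connected_iff no_cut_vertex_ear_tree)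
  then show ?thesis
    using C(1) assms(2,3) by (simp add: two_connected_def connected_iff pair_graph_iff)
qed

text \<open>At each vertex of \<open>D\<close> both cycles have two neighbours, hence the same ones.
  So no walk in \<open>C\<close> leaves \<open>D\<close>, and \<open>C\<close> is connected.\<close>

lemma cycle_subset_cycle_eq:
  assumes "is_cycle C" "is_cycle D" "parcs D \<subseteq> parcs C"
  shows "D = C"
proof -
  have same_nbrs: "{y. (x, y) \<in> parcs D} = {y. (x, y) \<in> parcs C}" if "x \<in> pverts D" for x
  proof -
    have "x \<in> pverts C"
      using that assms by (metis Field_parcs_cycle mono_Field subsetD)
    then obtain a b where ab: "a \<noteq> b" "{y. (x, y) \<in> parcs C} = {a, b}"
      using assms(1) by (metis cycle_vertex_nbrs)
    obtain c d where cd: "c \<noteq> d" "{y. (x, y) \<in> parcs D} = {c, d}"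
      using assms(2) \<open>x \<in> pverts D\<close> by (metis cycle_vertex_nbrs)
    have "{c, d} \<subseteq> {a, b}"
      using ab cd assms(3) by blast
    then show ?thesis
      using ab cd by auto
  qed
  have D: "pair_graph D"
    using assms by (simp add: pair_graph_cycle)
  obtain r where r: "r \<in> pverts D"
    using assms(2) by (rule is_cycle_form) auto
  then have r': "r \<in> pverts C"
    using assms by (metis Field_parcs_cycle mono_Field subsetD)
  have closed: "x \<in> pverts D" if "(r, x) \<in> (parcs C)\<^sup>*" for x
    using that
  proof (induction rule: rtrancl_induct)
    case (step y z)
    then have "(y, z) \<in> parcs D"
      using same_nbrs by blast
    then show ?case
      using D by (auto simp: pair_graph_iff)
  qed (rule r)
  then have "pverts C \<subseteq> pverts D"
    using cycle_connected[OF assms(1) r'] by blast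
  moreover have "parcs C \<subseteq> pverts C \<times> pverts C"
    using assms pair_graph_cycle by (auto simp: pair_graph_iff)
  ultimately have "parcs C \<subseteq> parcs D"
    using same_nbrs by blast
  then have "parcs C = parcs D"
    using assms(3) by blast
  moreover from this have "pverts C = pverts D"
    using Field_parcs_cycle[OF assms(1)] Field_parcs_cycle[OF assms(2)] by simp
  ultimately show ?thesis
    by (intro pair_pre_digraph.equality) simp_all
qed

text \<open>The elements of the cycle space. Unlike the arc sets of cycles they are closed under
  symmetric difference.\<close>

definition even_arcs :: "'a rel \<Rightarrow> bool" where
  "even_arcs A \<longleftrightarrow> sym A \<and> (\<forall>v. even (card {y. (v, y) \<in> A}))"

lemma even_arcs_cycle: "is_cycle C \<Longrightarrow> even_arcs (parcs C)"
  using pair_graph_cycle[of C] by (simp add: even_arcs_def cycle_even_degree pair_graph_iff)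

lemma even_arcs_sym_diff:
  assumes "even_arcs A" "even_arcs B" "finite A" "finite B"
  shows "even_arcs (sym_diff A B)"
  unfolding even_arcs_def
proof
  show "sym (sym_diff A B)"
    using assms by (auto simp: even_arcs_def sym_def)
  have fin: "finite {y. (v, y) \<in> X}" if "finite X" for v and X :: "'a rel"
    by (rule finite_subset[OF _ finite_imageI[OF that, of snd]]) force
  have "{y. (v, y) \<in> sym_diff A B} = sym_diff {y. (v, y) \<in> A} {y. (v, y) \<in> B}" for v
    by auto
  then show "\<forall>v. even (card {y. (v, y) \<in> sym_diff A B})"
    using assms odd_card_sym_diff[OF fin[of A] fin[of B]] by (simp add: even_arcs_def)
qed

section \<open>How even arc sets and induced cycles meet an ear\<close>

lemma path_all_or_none:
  assumes "sym A"
    and "\<And>ps x y z qs. xs = ps @ x # y # z # qs \<Longrightarrow> (x, y) \<in> A \<longleftrightarrow> (y, z) \<in> A"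
  shows "path_arcs xs \<subseteq> A \<or> path_arcs xs \<inter> A = {}"
  using assms(2)
proof (induction xs rule: path_arcs.induct)
  case (1 x y zs)
  have *: "(x, y) \<in> A \<longleftrightarrow> (y, x) \<in> A"
    using assms(1) by (blast dest: symD)
  have IH: "path_arcs (y # zs) \<subseteq> A \<or> path_arcs (y # zs) \<inter> A = {}"
  proof (rule "1.IH")
    fix ps x' y' z' qs
    assume "y # zs = ps @ x' # y' # z' # qs"
    then show "(x', y') \<in> A \<longleftrightarrow> (y', z') \<in> A"
      using "1.prems"[of "x # ps"] by simp
  qed
  show ?case
  proof (cases zs)
    case Nil
    then show ?thesis
      using * by auto
  next
    case (Cons z zs')
    then have "(x, y) \<in> A \<longleftrightarrow> (y, z) \<in> A"
      using "1.prems"[of "[]"] by simp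
    then show ?thesis
      using IH * Cons by auto
  qed
qed auto

text \<open>The inner vertices of an ear have degree two, so an even arc set that enters it runs through.\<close>

lemma ear_all_or_none:
  assumes "pair_graph G" "is_ear G u ys v" "even_arcs A" "A \<subseteq> parcs (add_ear G u ys v)"
  shows "path_arcs (u # ys @ [v]) \<subseteq> A \<or> path_arcs (u # ys @ [v]) \<inter> A = {}"
proof (rule path_all_or_none)
  note e = is_earD[OF assms(1,2)]
  show "sym A"
    using assms(3) by (simp add: even_arcs_def)
  fix ps x y z qs
  assume xs: "u # ys @ [v] = ps @ x # y # z # qs"
  \<comment> \<open>As \<open>y\<close> has both a predecessor and a successor in the list, it
    survives removal of the first and the last entry.\<close>
  have "y \<in> set ys"
  proof -
    have "ys @ [v] = tl (ps @ [x]) @ y # z # qs"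
      using xs by (cases ps) auto
    moreover have "butlast (ys @ [v]) = ys" "butlast (tl (ps @ [x]) @ y # z # qs) = tl (ps @ [x]) @ y # butlast (z # qs)"
      by (simp_all add: butlast_append)
    ultimately show ?thesis
      by (metis in_set_conv_decomp)
  qed
  then have "(y, t) \<notin> parcs G" for t
    using e(4) assms(1) by (auto simp: pair_graph_iff)
  then have N: "{t. (y, t) \<in> A} \<subseteq> {x, z}"
    using assms(4) path_arcs_middle[of ps x y z qs] e(7) unfolding parcs_add_ear xs by blast
  have "x \<noteq> z"
    using e(7) unfolding xs by simp
  \<comment> \<open>Only \<open>x\<close> and \<open>z\<close> can be neighbours of \<open>y\<close>
    in \<open>A\<close>; even degree rules out exactly one of them.\<close>
  have "card {t. (y, t) \<in> A} \<noteq> 1"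
    using assms(3) by (metis even_arcs_def odd_one)
  then have "{t. (y, t) \<in> A} \<noteq> {x}" "{t. (y, t) \<in> A} \<noteq> {z}"
    by auto
  then have "(y, x) \<in> A \<longleftrightarrow> (y, z) \<in> A"
    using N \<open>x \<noteq> z\<close> by blast
  then show "(x, y) \<in> A \<longleftrightarrow> (y, z) \<in> A"
    using \<open>sym A\<close> by (blast dest: symD)
qed

text \<open>The inner vertices are new, so among the vertices of the ear \<open>G\<close>
  contributes only the closing edge \<open>uv\<close>.\<close>

lemma ear_cycle:
  assumes "pair_graph G" "is_ear G u ys v"
  shows "induced_cycle (add_ear G u ys v) (cycle_graph (u # ys @ [v]))"
proof -
  note e = is_earD[OF assms]
  have "parcs G \<inter> ({u, v} \<union> set ys) \<times> ({u, v} \<union> set ys) = {(u, v), (v, u)}"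
    using assms(1) e unfolding pair_graph_iff irrefl_def by blast
  moreover have "path_arcs (u # ys @ [v]) \<subseteq> ({u, v} \<union> set ys) \<times> ({u, v} \<union> set ys)"
    using path_arcs_subset[of "u # ys @ [v]"] by auto
  moreover have "set (u # ys @ [v]) = {u, v} \<union> set ys"
    by auto
  ultimately have "parcs (cycle_graph (u # ys @ [v]))
      = parcs (add_ear G u ys v) \<inter> set (u # ys @ [v]) \<times> set (u # ys @ [v])"
    unfolding parcs_cycle_graph_ends parcs_add_ear Int_Un_distrib2
    by (simp only: Int_absorb2 Un_commute)
  moreover have "is_cycle (cycle_graph (u # ys @ [v]))"
    using e by (intro is_cycleI)
  ultimately show ?thesis
    using e(5,6) pair_graph_add_ear[OF assms]
    by (auto simp: induced_cycle_iff pverts_add_ear[OF assms])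
qed

text \<open>An induced cycle that uses an edge of the ear contains all of it, hence both
  \<open>u\<close> and \<open>v\<close>, hence the edge \<open>uv\<close> since it is induced. It
  then contains the ear cycle, and a cycle contains no other cycle. All remaining induced cycles
  live in \<open>G\<close>.\<close>

lemma induced_cycle_add_ear_iff:
  assumes "pair_graph G" "is_ear G u ys v"
  shows "induced_cycle (add_ear G u ys v) C \<longleftrightarrow> induced_cycle G C \<or> C = cycle_graph (u # ys @ [v])"
    (is "?L \<longleftrightarrow> _ \<or> C = ?D")
proof
  note e = is_earD[OF assms]
  let ?H = "add_ear G u ys v"
  have H: "pair_graph ?H"
    using assms by (rule pair_graph_add_ear)
  have out: "path_arcs (u # ys @ [v]) \<inter> pverts G \<times> pverts G = {}"
    using assms by (rule ear_arcs_outside)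
  {
    assume "induced_cycle G C \<or> C = ?D"
    moreover have "induced_cycle ?H C" if "induced_cycle G C"
      using that out assms H
      by (auto simp: induced_cycle_iff pverts_add_ear[OF assms])
    ultimately show ?L
      using ear_cycle[OF assms] by auto
  }
  assume ?L
  then have C: "is_cycle C" "pverts C \<subseteq> pverts G \<union> set ys" "parcs C = parcs ?H \<inter> pverts C \<times> pverts C"
    using H by (simp_all add: induced_cycle_iff pverts_add_ear[OF assms])
  consider "path_arcs (u # ys @ [v]) \<subseteq> parcs C" | "path_arcs (u # ys @ [v]) \<inter> parcs C = {}"
    using ear_all_or_none[OF assms even_arcs_cycle[OF C(1)]] C(3) by blast
  then show "induced_cycle G C \<or> C = ?D"
  proof cases
    case 1
    have "u \<in> pverts C" "v \<in> pverts C"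
      using 1 C(3) path_arcs_ends[OF e(3)] by blast+
    then have "parcs ?D \<subseteq> parcs C"
      unfolding parcs_cycle_graph_ends using 1 C(3) e(1,2)
      by (metis Int_iff SigmaI UnI1 Un_least empty_subsetI insert_subset parcs_add_ear)
    moreover have "is_cycle ?D"
      using e by (intro is_cycleI)
    ultimately show ?thesis
      using cycle_subset_cycle_eq C(1) by blast
  next
    case 2
    then have sub: "parcs C \<subseteq> parcs G"
      using C(3) by auto
    then have "pverts C \<subseteq> pverts G"
      using Field_parcs_cycle[OF C(1)] assms(1) unfolding pair_graph_iff Field_def by blast
    moreover have "parcs C = parcs G \<inter> pverts C \<times> pverts C"
      using sub C(3) by auto
    ultimately show ?thesis
      using C(1) assms(1) by (simp add: induced_cycle_iff)
  qed
qed

section \<open>Generation and independence of the induced cycles of an ear tree\<close>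

lemma induced_cycle_parcs_subset: "pair_graph G \<Longrightarrow> induced_cycle G C \<Longrightarrow> parcs C \<subseteq> parcs G"
  by (simp add: induced_cycle_iff)

text \<open>The induction runs over all even arc sets because adding the ear cycle stays among them,
  whereas the sum of two cycles need not be a cycle.\<close>

lemma even_arcs_generated:
  assumes "ear_tree G" "even_arcs A" "A \<subseteq> parcs G"
  shows "\<exists>S \<subseteq> {C. induced_cycle G C}. A = odd_arcs S"
  using assms
proof (induction arbitrary: A rule: ear_tree.induct)
  case (edge u v)
  have "A = {}"
  proof (rule ccontr)
    assume "A \<noteq> {}"
    then have "(u, v) \<in> A"
      using edge by (auto simp: even_arcs_def dest: symD)
    then have "{y. (u, y) \<in> A} = {v}"
      using edge by auto
    then have "card {y. (u, y) \<in> A} = 1"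
      by simp
    then show False
      using edge(2) by (metis even_arcs_def odd_one)
  qed
  then show ?case
    by (intro exI[of _ "{}"]) (simp add: odd_arcs_def)
next
  case (ear G u ys v)
  let ?D = "cycle_graph (u # ys @ [v])"
  let ?H = "add_ear G u ys v"
  have G: "pair_graph G"
    using ear.hyps(1) by (rule pair_graph_ear_tree)
  note e = is_earD[OF G ear.hyps(2)]
  note ind = induced_cycle_add_ear_iff[OF G ear.hyps(2)]
  have D: "is_cycle ?D"
    using e by (intro is_cycleI)
  have H: "pair_graph ?H"
    using G ear.hyps(2) by (rule pair_graph_add_ear)
  then have finH: "finite (parcs ?H)"
    unfolding pair_graph_iff by (meson finite_SigmaI finite_subset)
  consider "path_arcs (u # ys @ [v]) \<subseteq> A" | "path_arcs (u # ys @ [v]) \<inter> A = {}"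
    using ear_all_or_none[OF G ear.hyps(2) ear.prems] by blast
  then show ?case
  proof cases
    case 1
    have Dsub: "parcs ?D \<subseteq> parcs ?H"
      using e(1,2) by (simp only: parcs_cycle_graph_ends parcs_add_ear) blast
    have "even_arcs (sym_diff A (parcs ?D))"
      using ear.prems D Dsub finH by (intro even_arcs_sym_diff even_arcs_cycle) (auto intro: finite_subset)
    moreover have "sym_diff A (parcs ?D) \<subseteq> parcs G"
      using ear.prems(2) 1 e(1,2) unfolding parcs_cycle_graph_ends parcs_add_ear by blast
    ultimately obtain S where S: "S \<subseteq> {C. induced_cycle G C}" "sym_diff A (parcs ?D) = odd_arcs S"
      using ear.IH by blast
    have "finite S"
      using S(1) finite_induced_cycles[OF G] by (rule finite_subset)
    \<comment> \<open>Adding \<open>?D\<close> once more cancels the correction and restores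
      \<open>A\<close>.\<close>
    then have "odd_arcs (sym_diff S {?D}) = sym_diff (sym_diff A (parcs ?D)) (parcs ?D)"
      unfolding S(2) by (subst odd_arcs_sym_diff) simp_all
    then have "A = odd_arcs (sym_diff S {?D})"
      by blast
    moreover have "sym_diff S {?D} \<subseteq> {C. induced_cycle ?H C}"
      using S(1) ind by blast
    ultimately show ?thesis
      by blast
  next
    case 2
    then have "A \<subseteq> parcs G"
      using ear.prems(2) by auto
    then obtain S where "S \<subseteq> {C. induced_cycle G C}" "A = odd_arcs S"
      using ear.IH ear.prems(1) by blast
    then show ?thesis
      using ind by blast
  qed
qed

text \<open>The first edge of the last ear lies on no induced cycle other than the ear cycle, so a
  vanishing sum cannot involve that cycle, and the induction hypothesis treats the others.\<close>

lemma induced_cycles_independent: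
  assumes "ear_tree G" "S \<subseteq> {C. induced_cycle G C}" "odd_arcs S = {}"
  shows "S = {}"
  using assms
proof (induction arbitrary: S rule: ear_tree.induct)
  case (edge u v)
  have "\<not> induced_cycle (path_graph [u, v]) C" for C
  proof
    assume "induced_cycle (path_graph [u, v]) C"
    then have C: "is_cycle C" "pverts C \<subseteq> {u, v}"
      using pair_graph_ear_tree[OF ear_tree.edge[OF edge(1)]] by (simp_all add: induced_cycle_iff)
    then have "card (pverts C) \<le> card {u, v}"
      by (intro card_mono) auto
    also have "\<dots> \<le> 2"
      by (simp add: card_insert_if)
    finally show False
      using C(1) by (auto simp: is_cycle_def distinct_card)
  qed
  then show ?case
    using edge by blast
next
  case (ear G u ys v)
  let ?D = "cycle_graph (u # ys @ [v])"
  have G: "pair_graph G"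
    using ear.hyps(1) by (rule pair_graph_ear_tree)
  note e = is_earD[OF G ear.hyps(2)]
  have S: "C = ?D \<or> induced_cycle G C" if "C \<in> S" for C
    using that ear.prems(1) induced_cycle_add_ear_iff[OF G ear.hyps(2)] by blast
  have "?D \<notin> S"
  proof
    assume "?D \<in> S"
    obtain y ys' where y: "ys = y # ys'"
      using e(3) by (cases ys) auto
    have "(u, y) \<in> path_arcs (u # ys @ [v])"
      using y by simp
    moreover have "(u, y) \<notin> parcs G"
      using G e(4) y by (auto simp: pair_graph_iff)
    ultimately have "{C \<in> S. (u, y) \<in> parcs C} = {?D}"
      using \<open>?D \<in> S\<close> S induced_cycle_parcs_subset[OF G] parcs_cycle_graph_ends[of u ys v] by blast
    then have "(u, y) \<in> odd_arcs S"
      by (simp add: odd_arcs_def)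
    then show False
      using ear.prems(2) by simp
  qed
  then have "S \<subseteq> {C. induced_cycle G C}"
    using S by blast
  then show ?case
    using ear.IH ear.prems(2) by blast
qed

lemma cycle_basis_ear_tree:
  assumes "ear_tree G"
  shows "cycle_basis G {C. induced_cycle G C}"
proof -
  have G: "pair_graph G"
    using assms by (rule pair_graph_ear_tree)
  have "generates_cycles G {C. induced_cycle G C}"
    unfolding generates_cycles_def
  proof (intro allI impI)
    fix C
    assume C: "is_cycle C \<and> subgraph (with_proj C) (with_proj G)"
    then have "even_arcs (parcs C)" "parcs C \<subseteq> parcs G"
      by (simp_all add: even_arcs_cycle subgraph_with_proj_iff)
    then show "\<exists>S \<subseteq> {C. induced_cycle G C}. C = ring_sum S"
      using even_arcs_generated[OF assms] C by (simp add: cycle_eq_ring_sum_iff)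
  qed
  moreover have "\<not> generates_cycles G B'" if B': "B' \<subset> {C. induced_cycle G C}" for B'
  proof
    assume gen: "generates_cycles G B'"
    obtain C where C: "induced_cycle G C" "C \<notin> B'"
      using B' by blast
    then have "is_cycle C" "subgraph (with_proj C) (with_proj G)"
      by (simp_all add: induced_cycle_def induced_subgraph_def)
    then obtain S where S: "S \<subseteq> B'" "parcs C = odd_arcs S"
      using gen cycle_eq_ring_sum_iff unfolding generates_cycles_def by metis
    have "finite S"
      using S(1) B' finite_induced_cycles[OF G] by (meson finite_subset psubset_imp_subset)
    \<comment> \<open>If \<open>C\<close> were a sum over \<open>S\<close>, then \<open>S\<close>
      together with \<open>C\<close> would be a nonempty family with zero sum, against
      independence.\<close>
    then have "odd_arcs (sym_diff S {C}) = {}"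
      using S(2) by (subst odd_arcs_sym_diff) simp_all
    moreover have "sym_diff S {C} \<subseteq> {C. induced_cycle G C}"
      using S(1) B' C(1) by blast
    ultimately have "sym_diff S {C} = {}"
      using induced_cycles_independent[OF assms] by blast
    then show False
      using S(1) C(2) by blast
  qed
  moreover have "pair_graph C \<and> subgraph (with_proj C) (with_proj G) \<and> eulerian C"
    if "induced_cycle G C" for C
    using that by (simp add: induced_cycle_def induced_subgraph_def pair_graph_cycle eulerian_cycle)
  ultimately show ?thesis
    unfolding cycle_basis_def by blast
qed

section \<open>Subdividing an edge\<close>

lemma subdivide_commute: "subdivide G (a, b) w = subdivide G (b, a) w"
  by (rule pair_pre_digraph.equality) auto

text \<open>Cut open at \<open>ab\<close>, the cycle is a path from \<open>a\<close> to
  \<open>b\<close>; the new vertex \<open>w\<close> now closes this path in place of the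
  edge.\<close>

lemma is_cycle_subdivide:
  assumes "is_cycle C" "(a, b) \<in> parcs C" "w \<notin> pverts C"
  shows "is_cycle (subdivide C (a, b) w)"
proof -
  obtain ys where ys: "ys \<noteq> []" "distinct (a # ys @ [b])" "C = cycle_graph (a # ys @ [b])"
    using is_cycle_through_arc[OF assms(1,2)] by blast
  have "(a, b) \<notin> path_arcs (a # ys @ [b])" "(b, a) \<notin> path_arcs (a # ys @ [b])"
    using path_arcs_inner[of _ _ a ys b] ys(1,2) by auto
  then have "path_arcs (a # ys @ [b]) = parcs C - {(a, b), (b, a)}"
    unfolding ys(3) parcs_cycle_graph_ends by blast
  moreover have "parcs (cycle_graph (a # (ys @ [b]) @ [w]))
      = path_arcs (a # ys @ [b]) \<union> {(b, w), (w, b)} \<union> {(a, w), (w, a)}"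
    unfolding parcs_cycle_graph_ends using path_arcs_snoc2[of "a # ys" b w] by simp
  ultimately have "subdivide C (a, b) w = cycle_graph (a # (ys @ [b]) @ [w])"
    by (intro pair_pre_digraph.equality) (auto simp: ys(3))
  moreover have "is_cycle (cycle_graph (a # (ys @ [b]) @ [w]))"
    using ys assms(3) by (intro is_cycleI) auto
  ultimately show ?thesis
    by simp
qed

text \<open>The map that subdividing \<open>ab\<close> induces on the arc sets of subgraphs. Being
  additive, it carries relations between cycles to the subdivided graph.\<close>

definition subdivide_arcs :: "'a \<Rightarrow> 'a \<Rightarrow> 'a \<Rightarrow> 'a rel \<Rightarrow> 'a rel" where
  "subdivide_arcs a b w A =
     (if (a, b) \<in> A then A - {(a, b), (b, a)} \<union> {(a, w), (w, a), (w, b), (b, w)} else A)"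

lemma subdivide_arcs_sym_diff:
  assumes "sym A" "sym B" "w \<notin> Field A" "w \<notin> Field B"
  shows "subdivide_arcs a b w (sym_diff A B) = sym_diff (subdivide_arcs a b w A) (subdivide_arcs a b w B)"
proof -
  have "(x, w) \<notin> A" "(w, x) \<notin> A" "(x, w) \<notin> B" "(w, x) \<notin> B" for x
    using assms(3,4) by (auto simp: Field_def)
  moreover have "(a, b) \<in> A \<longleftrightarrow> (b, a) \<in> A" "(a, b) \<in> B \<longleftrightarrow> (b, a) \<in> B"
    using assms(1,2) by (blast dest: symD)+
  ultimately show ?thesis
    by (cases "(a, b) \<in> A"; cases "(a, b) \<in> B") (auto simp: subdivide_arcs_def)
qed

text \<open>A cycle through \<open>ab\<close> is subdivided along with the graph. An induced cycle
  not using the edge misses \<open>a\<close> or \<open>b\<close>, and subdivision leaves it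
  untouched.\<close>

lemma induced_cycle_subdivide:
  assumes "pair_graph G" "(a, b) \<in> parcs G" "w \<notin> pverts G" "induced_cycle G C"
  obtains C' where "induced_cycle (subdivide G (a, b) w) C'" "parcs C' = subdivide_arcs a b w (parcs C)"
proof -
  have C: "is_cycle C" "pverts C \<subseteq> pverts G" "parcs C = parcs G \<inter> pverts C \<times> pverts C"
    using assms(1,4) by (simp_all add: induced_cycle_iff)
  have H: "pair_graph (subdivide G (a, b) w)"
    using assms by (intro pair_graph.pair_graph_subdivide)
  have w: "w \<notin> pverts C"
    using C(2) assms(3) by blast
  show ?thesis
  proof (cases "(a, b) \<in> parcs C")
    case True
    then have ab: "a \<in> pverts C" "b \<in> pverts C"
      using C(3) by auto
    have "is_cycle (subdivide C (a, b) w)"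
      using C(1) True w by (rule is_cycle_subdivide)
    moreover have "parcs (subdivide C (a, b) w)
        = parcs (subdivide G (a, b) w) \<inter> (pverts C \<union> {w}) \<times> (pverts C \<union> {w})"
    proof -
      have "(x, w) \<notin> parcs G" "(w, x) \<notin> parcs G" for x
        using assms(1,3) by (auto simp: pair_graph_iff)
      then show ?thesis
        using C(3) ab by (simp only: arcs_subdivide) blast
    qed
    ultimately have "induced_cycle (subdivide G (a, b) w) (subdivide C (a, b) w)"
      unfolding induced_cycle_iff[OF H] verts_subdivide using C(2) by blast
    then show ?thesis
      by (rule that) (simp add: True subdivide_arcs_def)
  next
    case False
    then have not_ab: "a \<notin> pverts C \<or> b \<notin> pverts C"
      using C(3) assms(2) by blast
    have "parcs C = parcs (subdivide G (a, b) w) \<inter> pverts C \<times> pverts C"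
      unfolding arcs_subdivide using C(3) w not_ab by blast
    then have "induced_cycle (subdivide G (a, b) w) C"
      unfolding induced_cycle_iff[OF H] verts_subdivide using C(1,2) by blast
    then show ?thesis
      by (rule that) (simp add: False subdivide_arcs_def)
  qed
qed

section \<open>Relations between induced cycles\<close>

text \<open>The one consequence of the basis property that the converse works with. The word
  triangle refers to three cycles with zero sum, not to a cycle of length three.\<close>

definition no_triangle_relation :: "'a pair_pre_digraph \<Rightarrow> bool" where
  "no_triangle_relation G \<longleftrightarrow> (\<forall>C1 C2 C3. induced_cycle G C1 \<longrightarrow> induced_cycle G C2 \<longrightarrow>
     induced_cycle G C3 \<longrightarrow> parcs C3 \<noteq> sym_diff (parcs C1) (parcs C2))"

text \<open>Given such a relation, \<open>C3\<close> can be replaced in every sum by the other two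
  cycles, so the family without \<open>C3\<close> still generates, against minimality.\<close>

lemma no_triangle_relation_if_cycle_basis:
  assumes "pair_graph G" "cycle_basis G {C. induced_cycle G C}"
  shows "no_triangle_relation G"
  unfolding no_triangle_relation_def
proof (intro allI impI notI)
  let ?B = "{C. induced_cycle G C}"
  fix C1 C2 C3
  assume C: "induced_cycle G C1" "induced_cycle G C2" "induced_cycle G C3"
    and rel: "parcs C3 = sym_diff (parcs C1) (parcs C2)"
  have nonempty: "parcs C \<noteq> {}" if "induced_cycle G C" for C
    using that by (simp add: induced_cycle_def parcs_cycle_nonempty)
  \<comment> \<open>If two of the cycles coincided, the relation would make the third one
    empty.\<close>
  have neq: "C1 \<noteq> C2" "C3 \<noteq> C1" "C3 \<noteq> C2"
    using rel nonempty[OF C(1)] nonempty[OF C(2)] nonempty[OF C(3)] by auto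
  let ?R = "{C1, C2, C3}"
  have R: "?R = sym_diff (sym_diff {C1} {C2}) {C3}"
    using neq by auto
  have zero: "odd_arcs ?R = {}"
  proof -
    have "odd_arcs (sym_diff {C1} {C2}) = parcs C3"
      unfolding rel by (subst odd_arcs_sym_diff) simp_all
    then show ?thesis
      unfolding R by (subst odd_arcs_sym_diff) simp_all
  qed
  have "generates_cycles G (?B - {C3})"
    unfolding generates_cycles_def
  proof (intro allI impI)
    fix C
    assume C': "is_cycle C \<and> subgraph (with_proj C) (with_proj G)"
    then obtain S where S: "S \<subseteq> ?B" "parcs C = odd_arcs S"
      using assms(2) cycle_eq_ring_sum_iff unfolding cycle_basis_def generates_cycles_def by metis
    show "\<exists>S \<subseteq> ?B - {C3}. C = ring_sum S"
    proof (cases "C3 \<in> S")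
      case True
      have "finite S"
        using S(1) finite_induced_cycles[OF assms(1)] by (rule finite_subset)
      then have "parcs C = odd_arcs (sym_diff S ?R)"
        by (subst odd_arcs_sym_diff) (simp_all add: zero S(2))
      moreover have "sym_diff S ?R \<subseteq> ?B - {C3}"
        using S(1) C True by blast
      ultimately show ?thesis
        using C' cycle_eq_ring_sum_iff by blast
    next
      case False
      then show ?thesis
        using S C' cycle_eq_ring_sum_iff by blast
    qed
  qed
  moreover have "?B - {C3} \<subset> ?B"
    using C(3) by blast
  ultimately show False
    using assms(2) unfolding cycle_basis_def by blast
qed

text \<open>By contraposition: the images of three cycles with zero sum are induced cycles of the
  subdivided graph, and their sum is again zero.\<close>

lemma no_triangle_relation_subdivideD:
  assumes "pair_graph G" "(a, b) \<in> parcs G" "w \<notin> pverts G"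
    "no_triangle_relation (subdivide G (a, b) w)"
  shows "no_triangle_relation G"
  unfolding no_triangle_relation_def
proof (intro allI impI notI)
  fix C1 C2 C3
  assume C: "induced_cycle G C1" "induced_cycle G C2" "induced_cycle G C3"
    and rel: "parcs C3 = sym_diff (parcs C1) (parcs C2)"
  obtain D1 where D1: "induced_cycle (subdivide G (a, b) w) D1" "parcs D1 = subdivide_arcs a b w (parcs C1)"
    using induced_cycle_subdivide[OF assms(1-3) C(1)] by blast
  obtain D2 where D2: "induced_cycle (subdivide G (a, b) w) D2" "parcs D2 = subdivide_arcs a b w (parcs C2)"
    using induced_cycle_subdivide[OF assms(1-3) C(2)] by blast
  obtain D3 where D3: "induced_cycle (subdivide G (a, b) w) D3" "parcs D3 = subdivide_arcs a b w (parcs C3)"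
    using induced_cycle_subdivide[OF assms(1-3) C(3)] by blast
  have "sym (parcs C)" "w \<notin> Field (parcs C)" if "induced_cycle G C" for C
  proof -
    have "is_cycle C" "pverts C \<subseteq> pverts G"
      using that assms(1) by (simp_all add: induced_cycle_iff)
    then show "sym (parcs C)" "w \<notin> Field (parcs C)"
      using pair_graph_cycle[of C] assms(3) by (auto simp: pair_graph_iff Field_parcs_cycle)
  qed
  then have "parcs D3 = sym_diff (parcs D1) (parcs D2)"
    unfolding D1(2) D2(2) D3(2) rel using C by (intro subdivide_arcs_sym_diff)
  then show False
    using assms(4) D1(1) D2(1) D3(1) unfolding no_triangle_relation_def by blast
qed

text \<open>Two polygons glued along \<open>ab\<close> and otherwise disjoint. The last clause
  ensures that \<open>ab\<close> is the only chord of their sum.\<close>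

definition twin_cycles :: "'a pair_pre_digraph \<Rightarrow> 'a \<Rightarrow> 'a \<Rightarrow> 'a list \<Rightarrow> 'a list \<Rightarrow> bool" where
  "twin_cycles G a b xs ys \<longleftrightarrow> xs \<noteq> [] \<and> ys \<noteq> [] \<and> distinct (a # xs @ b # ys) \<and>
     induced_cycle G (cycle_graph (a # xs @ [b])) \<and> induced_cycle G (cycle_graph (a # ys @ [b])) \<and>
     parcs G \<inter> set xs \<times> set ys = {}"

text \<open>
  Once the common edge of the two cycles is subdivided, their sum is an induced cycle as well.
\<close>

lemma twin_cycles_triangle_relation:
  assumes "pair_graph G" "(a, b) \<in> parcs G" "w \<notin> pverts G" "twin_cycles G a b xs ys"
  shows "\<not> no_triangle_relation (subdivide G (a, b) w)"
proof
  let ?H = "subdivide G (a, b) w"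
  let ?X = "path_arcs (a # xs @ [b])" and ?Y = "path_arcs (a # ys @ [b])"
  let ?C = "cycle_graph (a # xs @ b # rev ys)"
  let ?K = "{(a, w), (w, a), (w, b), (b, w)}"
  assume no: "no_triangle_relation ?H"
  have t: "xs \<noteq> []" "ys \<noteq> []" "distinct (a # xs @ b # ys)" "parcs G \<inter> set xs \<times> set ys = {}"
    "induced_cycle G (cycle_graph (a # xs @ [b]))" "induced_cycle G (cycle_graph (a # ys @ [b]))"
    using assms(4) by (simp_all add: twin_cycles_def)
  have notX: "(a, b) \<notin> ?X" "(b, a) \<notin> ?X"
    using path_arcs_inner[of _ _ a xs b] t(1,3) by auto
  have notY: "(a, b) \<notin> ?Y" "(b, a) \<notin> ?Y"
    using path_arcs_inner[of _ _ a ys b] t(2,3) by auto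
  obtain D1 where D1: "induced_cycle ?H D1" "parcs D1 = subdivide_arcs a b w (?X \<union> {(a, b), (b, a)})"
    using induced_cycle_subdivide[OF assms(1-3) t(5)] unfolding parcs_cycle_graph_ends by blast
  obtain D2 where D2: "induced_cycle ?H D2" "parcs D2 = subdivide_arcs a b w (?Y \<union> {(a, b), (b, a)})"
    using induced_cycle_subdivide[OF assms(1-3) t(6)] unfolding parcs_cycle_graph_ends by blast
  have D1': "parcs D1 = ?X \<union> ?K"
    unfolding D1(2) subdivide_arcs_def using notX by auto
  have D2': "parcs D2 = ?Y \<union> ?K"
    unfolding D2(2) subdivide_arcs_def using notY by auto
  have Garcs: "set (a # xs @ [b]) \<subseteq> pverts G" "set (a # ys @ [b]) \<subseteq> pverts G"
    "?X \<union> {(a, b), (b, a)} = parcs G \<inter> set (a # xs @ [b]) \<times> set (a # xs @ [b])"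
    "?Y \<union> {(a, b), (b, a)} = parcs G \<inter> set (a # ys @ [b]) \<times> set (a # ys @ [b])"
    using t(5,6) unfolding induced_cycle_iff[OF assms(1)] parcs_cycle_graph_ends pverts_cycle_graph
    by - (elim conjE, assumption)+
  have C: "is_cycle ?C"
    using t(1-3) unfolding is_cycle_def
    by (intro exI[of _ "a # xs @ b # rev ys"]) (cases xs; auto)
  have parcsC: "parcs ?C = ?X \<union> ?Y"
  proof -
    have "parcs ?C = path_arcs ((a # xs) @ b # rev ys @ [a])"
      by (simp add: parcs_cycle_graph)
    also have "\<dots> = ?X \<union> path_arcs (b # rev ys @ [a])"
      using path_arcs_append[of "a # xs" b "rev ys @ [a]"] by simp
    also have "path_arcs (b # rev ys @ [a]) = ?Y"
      using path_arcs_rev[of "a # ys @ [b]"] by simp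
    finally show ?thesis .
  qed
  have "?X \<inter> ?Y = {}"
  proof -
    have "(x, y) \<notin> ?Y" if "(x, y) \<in> ?X" for x y
      using path_arcs_inner[OF that t(1)] t(3) path_arcsD[of x y "a # ys @ [b]"] by auto
    then show ?thesis by auto
  qed
  moreover have "(x, w) \<notin> ?X \<and> (w, x) \<notin> ?X \<and> (x, w) \<notin> ?Y \<and> (w, x) \<notin> ?Y" for x
    using Garcs(1,2) assms(3) path_arcs_subset[of "a # xs @ [b]"] path_arcs_subset[of "a # ys @ [b]"]
    by blast
  \<comment> \<open>The path through \<open>w\<close> belongs to both \<open>D1\<close> and
    \<open>D2\<close> and cancels.\<close>
  ultimately have "parcs ?C = sym_diff (parcs D1) (parcs D2)"
    unfolding parcsC D1' D2' by blast
  moreover have "induced_cycle ?H ?C"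
  proof -
    have V: "pverts ?C = set (a # xs @ [b]) \<union> set (a # ys @ [b])"
      by auto
    have cross: "parcs G \<inter> set ys \<times> set xs = {}"
      using t(4) assms(1) unfolding pair_graph_iff by (blast dest: symD)
    \<comment> \<open>In \<open>G\<close> the edge \<open>ab\<close> is the only chord of
      \<open>?C\<close>, and subdivision removes it.\<close>
    have "parcs G \<inter> pverts ?C \<times> pverts ?C = ?X \<union> ?Y \<union> {(a, b), (b, a)}"
    proof -
      have "parcs G \<inter> pverts ?C \<times> pverts ?C
          = (parcs G \<inter> set (a # xs @ [b]) \<times> set (a # xs @ [b]))
            \<union> (parcs G \<inter> set (a # ys @ [b]) \<times> set (a # ys @ [b]))"
      proof -
        have "set (a # xs @ [b]) = {a, b} \<union> set xs" "set (a # ys @ [b]) = {a, b} \<union> set ys"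
          by auto
        then show ?thesis
          using t(4) cross unfolding V by blast
      qed
      then show ?thesis
        using Garcs(3,4) by blast
    qed
    moreover have "w \<notin> pverts ?C"
      using Garcs(1,2) assms(3) unfolding V by blast
    ultimately have "parcs ?C = parcs ?H \<inter> pverts ?C \<times> pverts ?C"
      unfolding parcsC arcs_subdivide using notX notY by blast
    moreover have "pverts ?C \<subseteq> pverts ?H"
      using Garcs(1,2) unfolding V verts_subdivide by blast
    ultimately show ?thesis
      using C induced_cycle_iff[OF pair_graph.pair_graph_subdivide[OF assms(1-3)]] by blast
  qed
  ultimately show False
    using no D1(1) D2(1) unfolding no_triangle_relation_def by blast
qed

text \<open>An edge off the cycle of the last ear belongs to the earlier graph and differs from
  \<open>uv\<close>, so that graph is already more than a single edge and the induction hypothesis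
  applies.\<close>

lemma ear_tree_edge_in_induced_cycle:
  assumes "ear_tree G" "(a, b) \<in> parcs G" "3 \<le> card (pverts G)"
  shows "\<exists>C. induced_cycle G C \<and> (a, b) \<in> parcs C"
  using assms
proof (induction rule: ear_tree.induct)
  case (edge u v)
  then show ?case by simp
next
  case (ear G u ys v)
  let ?D = "cycle_graph (u # ys @ [v])"
  have G: "pair_graph G"
    using ear.hyps(1) by (rule pair_graph_ear_tree)
  note e = is_earD[OF G ear.hyps(2)]
  note ind = induced_cycle_add_ear_iff[OF G ear.hyps(2)]
  show ?case
  proof (cases "(a, b) \<in> parcs ?D")
    case True
    then show ?thesis
      using ind by blast
  next
    case False
    then have ab: "(a, b) \<in> parcs G" "(a, b) \<noteq> (u, v)" "(a, b) \<noteq> (v, u)"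
      using ear.prems(1) unfolding parcs_add_ear parcs_cycle_graph_ends by blast+
    have "3 \<le> card (pverts G)"
      using G ab e(1) by (rule card_ge_3_if_two_edges)
    then show ?thesis
      using ear.IH ab(1) ind by blast
  qed
qed

lemma subdivide_add_ear_inner:
  assumes "pair_graph G" "is_ear G u ys v" "u # ys @ [v] = ps @ a # b # qs"
    "w \<notin> pverts G \<union> set ys"
  shows "\<exists>zs. is_ear G u zs v \<and> subdivide (add_ear G u ys v) (a, b) w = add_ear G u zs v"
proof -
  note e = is_earD[OF assms(1,2)]
  \<comment> \<open>The vertex \<open>w\<close> is inserted between \<open>a\<close> and
    \<open>b\<close>; the cases separate whether \<open>a\<close> is the end \<open>u\<close> and
    whether \<open>b\<close> is the end \<open>v\<close>.\<close>
  obtain zs where zs: "u # zs @ [v] = ps @ a # w # b # qs"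
  proof (cases ps)
    case Nil
    then show ?thesis
      using that[of "w # ys"] assms(3) by simp
  next
    case (Cons p ps')
    then have *: "p = u" "ys @ [v] = ps' @ a # b # qs"
      using assms(3) by auto
    show ?thesis
    proof (cases qs rule: rev_cases)
      case Nil
      then show ?thesis
        using that[of "ps' @ [a, w]"] * Cons by simp
    next
      case (snoc qs' q)
      then show ?thesis
        using that[of "ps' @ a # w # b # qs'"] * Cons by simp
    qed
  qed
  \<comment> \<open>Comparing multisets yields both the vertices and the distinctness of
    \<open>zs\<close> without repeating the case distinction.\<close>
  have "mset (u # zs @ [v]) = add_mset w (mset (u # ys @ [v]))"
    unfolding zs assms(3) by simp
  then have m: "mset zs = add_mset w (mset ys)"
    by simp
  have set_zs: "set zs = insert w (set ys)"
    using arg_cong[OF m, of set_mset] by simp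
  have "distinct (w # ys)"
    using assms(4) e(7) by simp
  then have "distinct zs"
    using m by (metis mset.simps(2) mset_eq_imp_distinct_iff)
  then have ear: "is_ear G u zs v"
    using assms(2,4) set_zs by (auto simp: is_ear_def)
  have d: "distinct (ps @ a # b # qs)"
    using e(7) unfolding assms(3) .
  have ys_arcs: "path_arcs (u # ys @ [v]) = path_arcs (ps @ [a]) \<union> {(a, b), (b, a)} \<union> path_arcs (b # qs)"
    unfolding assms(3) by (subst path_arcs_append) auto
  have zs_arcs: "path_arcs (u # zs @ [v])
      = path_arcs (ps @ [a]) \<union> {(a, w), (w, a), (w, b), (b, w)} \<union> path_arcs (b # qs)"
    unfolding zs by (subst path_arcs_append) auto
  have "(a, b) \<notin> path_arcs (ps @ [a]) \<union> path_arcs (b # qs)"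
    "(b, a) \<notin> path_arcs (ps @ [a]) \<union> path_arcs (b # qs)"
    using d by (auto dest: path_arcsD)
  moreover have "(a, b) \<notin> parcs G" "(b, a) \<notin> parcs G"
    using ear_arcs_outside[OF assms(1,2)] assms(1) unfolding ys_arcs pair_graph_iff by blast+
  ultimately have "parcs (subdivide (add_ear G u ys v) (a, b) w) = parcs (add_ear G u zs v)"
    unfolding arcs_subdivide parcs_add_ear ys_arcs zs_arcs by blast
  then have "subdivide (add_ear G u ys v) (a, b) w = add_ear G u zs v"
    using set_zs
    by (intro pair_pre_digraph.equality)
      (simp_all add: pverts_add_ear[OF assms(1,2)] pverts_add_ear[OF assms(1) ear])
  then show ?thesis
    using ear by blast
qed

text \<open>There are three positions for \<open>ab\<close> relative to the last ear. On its path,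
  subdivision lengthens the ear. Elsewhere in the earlier graph, either outcome of the induction
  hypothesis survives adding the ear. If \<open>ab\<close> is the base edge \<open>uv\<close>, the
  ear cycle is a twin of any earlier induced cycle through \<open>ab\<close>.\<close>

lemma ear_tree_subdivide_or_twin_cycles:
  assumes "ear_tree G" "(a, b) \<in> parcs G" "w \<notin> pverts G" "3 \<le> card (pverts G)"
  shows "ear_tree (subdivide G (a, b) w) \<or> (\<exists>xs ys. twin_cycles G a b xs ys)"
  using assms
proof (induction rule: ear_tree.induct)
  case (edge u v)
  then show ?case by simp
next
  case (ear G u ys v)
  let ?D = "cycle_graph (u # ys @ [v])"
  let ?H = "add_ear G u ys v"
  let ?P = "path_arcs (u # ys @ [v])"
  have G: "pair_graph G"
    using ear.hyps(1) by (rule pair_graph_ear_tree)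
  have H: "pair_graph ?H"
    using G ear.hyps(2) by (rule pair_graph_add_ear)
  note e = is_earD[OF G ear.hyps(2)]
  note ind = induced_cycle_add_ear_iff[OF G ear.hyps(2)]
  have w: "w \<notin> pverts G \<union> set ys"
    using ear.prems(2) pverts_add_ear[OF G ear.hyps(2)] by simp
  have out: "?P \<inter> pverts G \<times> pverts G = {}"
    using G ear.hyps(2) by (rule ear_arcs_outside)
  consider (inner) "(a, b) \<in> ?P"
    | (other) "(a, b) \<in> parcs G" "(a, b) \<noteq> (u, v)" "(a, b) \<noteq> (v, u)"
    | (base) "(a, b) = (u, v) \<or> (a, b) = (v, u)"
    using ear.prems(1) unfolding parcs_add_ear by blast
  then show ?case
  proof cases
    case inner
    then obtain ps qs where "u # ys @ [v] = ps @ a # b # qs \<or> u # ys @ [v] = ps @ b # a # qs"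
      using path_arcs_split by fast
    then obtain zs where "is_ear G u zs v" "subdivide ?H (a, b) w = add_ear G u zs v"
      using subdivide_add_ear_inner[OF G ear.hyps(2) _ w] subdivide_commute by metis
    then show ?thesis
      using ear.hyps(1) ear_tree.ear by metis
  next
    case other
    have "3 \<le> card (pverts G)"
      using G other e(1) by (rule card_ge_3_if_two_edges)
    then consider "ear_tree (subdivide G (a, b) w)" | xs zs where "twin_cycles G a b xs zs"
      using ear.IH other(1) w by blast
    then show ?thesis
    proof cases
      case 1
      \<comment> \<open>The edge \<open>uv\<close> is not the subdivided one, so the ear can be
        attached after the subdivision.\<close>
      have ear': "is_ear (subdivide G (a, b) w) u ys v"
        using ear.hyps(2) other w by (auto simp: is_ear_def)
      have sub: "pair_graph (subdivide G (a, b) w)"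
        using 1 by (rule pair_graph_ear_tree)
      have "(a, b) \<notin> ?P" "(b, a) \<notin> ?P"
        using other(1) out G unfolding pair_graph_iff by blast+
      then have "subdivide ?H (a, b) w = add_ear (subdivide G (a, b) w) u ys v"
        by (intro pair_pre_digraph.equality)
          (auto simp: pverts_add_ear[OF G ear.hyps(2)] pverts_add_ear[OF sub ear'])
      then show ?thesis
        using ear_tree.ear[OF 1 ear'] by simp
    next
      case (2 xs zs)
      then have "set xs \<subseteq> pverts G" "set zs \<subseteq> pverts G"
        by (auto simp: twin_cycles_def induced_cycle_iff[OF G])
      then have "parcs ?H \<inter> set xs \<times> set zs = parcs G \<inter> set xs \<times> set zs"
        unfolding parcs_add_ear using out by blast
      then have "twin_cycles ?H a b xs zs"
        using 2 ind unfolding twin_cycles_def by simp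
      then show ?thesis by blast
    qed
  next
    case base
    have abD: "(a, b) \<in> parcs ?D"
      using base unfolding parcs_cycle_graph_ends by blast
    have D: "is_cycle ?D"
      using e by (intro is_cycleI)
    have ab: "(a, b) \<in> parcs G" "{a, b} = {u, v}"
      using base e(1,2) by auto
    show ?thesis
    proof (cases "3 \<le> card (pverts G)")
      case True
      then obtain C where C: "induced_cycle G C" "(a, b) \<in> parcs C"
        using ear_tree_edge_in_induced_cycle[OF ear.hyps(1) ab(1)] by blast
      then obtain zs where zs: "zs \<noteq> []" "distinct (a # zs @ [b])" "C = cycle_graph (a # zs @ [b])"
        using is_cycle_through_arc[OF _ C(2)] unfolding induced_cycle_iff[OF G] by blast
      obtain xs where xs: "xs \<noteq> []" "distinct (a # xs @ [b])" "?D = cycle_graph (a # xs @ [b])"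
        using is_cycle_through_arc[OF D abD] by blast
      \<comment> \<open>Since \<open>ab\<close> may be \<open>uv\<close> or \<open>vu\<close>, the
        lists \<open>xs\<close> and \<open>ys\<close> are compared only as sets.\<close>
      have "set (u # ys @ [v]) = set (a # xs @ [b])"
        using arg_cong[OF xs(3), of pverts] by (simp only: pverts_cycle_graph)
      then have "set (u # ys @ [v]) - {u, v} = set (a # xs @ [b]) - {a, b}"
        using ab(2) by simp
      moreover have "set (u # ys @ [v]) - {u, v} = set ys" "set (a # xs @ [b]) - {a, b} = set xs"
        using e(7) xs(2) by auto
      ultimately have set_xs: "set xs = set ys"
        by simp
      have zsG: "set zs \<subseteq> pverts G - {u, v}"
        using C(1) zs(2) ab(2) unfolding induced_cycle_iff[OF G] zs(3)
        by (auto simp: doubleton_eq_iff)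
      have "(x, z) \<notin> parcs ?H" if "x \<in> set xs" "z \<in> set zs" for x z
      proof -
        have "(x, z) \<notin> parcs G"
          using that set_xs e(4) G by (auto simp: pair_graph_iff)
        moreover have "z \<notin> set (u # ys @ [v])"
          using that zsG e(4) by auto
        ultimately show ?thesis
          using path_arcsD[of x z "u # ys @ [v]"] unfolding parcs_add_ear by blast
      qed
      moreover have "distinct (a # xs @ b # zs)"
        using xs(2) zs(2) zsG set_xs e(4) by auto
      ultimately have "twin_cycles ?H a b xs zs"
        using xs zs C(1) ind unfolding twin_cycles_def by auto
      then show ?thesis by blast
    next
      case False
      \<comment> \<open>Before this ear there was only the initial edge, so the whole graph is one
        cycle and stays one when subdivided.\<close>
      then have "G = path_graph [u, v]"
        using G e(1) by (intro pair_graph_eq_edge) auto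
      then have "?H = ?D"
        by (simp add: add_ear_edge_eq_cycle)
      then show ?thesis
        using is_cycle_subdivide[OF D abD] ear.prems(2) ear_tree_cycle by auto
    qed
  qed
qed

section \<open>Suppressing a vertex of degree two\<close>

text \<open>The first step of a walk from \<open>w\<close> to a third vertex that avoids
  \<open>c\<close>. Taking for \<open>c\<close> a known neighbour produces a second one.\<close>

lemma no_cut_vertex_nbr:
  assumes "no_cut_vertex G" "3 \<le> card (pverts G)" "w \<in> pverts G" "c \<noteq> w"
  obtains y where "(w, y) \<in> parcs G" "y \<noteq> c"
proof -
  have "\<not> pverts G \<subseteq> {w, c}"
    using assms(2) card_mono[of "{w, c}" "pverts G"] by (auto simp: card_insert_if split: if_splits)
  then obtain z where "z \<in> pverts G" "z \<noteq> w" "z \<noteq> c"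
    by blast
  then have "(w, z) \<in> (avoiding (parcs G) c)\<^sup>*"
    using assms by (auto simp: no_cut_vertex_def)
  then obtain y where "(w, y) \<in> avoiding (parcs G) c"
    using \<open>z \<noteq> w\<close> by (metis converse_rtranclE)
  then show ?thesis
    using that by (auto simp: avoiding_def)
qed

text \<open>If \<open>a\<close> and \<open>b\<close> are the neighbours of \<open>w\<close>, this
  deletes \<open>w\<close> when \<open>ab\<close> is already an edge and undoes a subdivision
  otherwise; one operation serves both cases of the induction.\<close>

definition suppress :: "'a pair_pre_digraph \<Rightarrow> 'a \<Rightarrow> 'a \<Rightarrow> 'a \<Rightarrow> 'a pair_pre_digraph" where
  "suppress G w a b =
     \<lparr>pverts = pverts G - {w}, parcs = avoiding (parcs G) w \<union> {(a, b), (b, a)}\<rparr>"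

lemma pair_graph_suppress:
  assumes "pair_graph G" "a \<in> pverts G - {w}" "b \<in> pverts G - {w}" "a \<noteq> b"
  shows "pair_graph (suppress G w a b)"
proof -
  have "sym (avoiding (parcs G) w)"
    using assms(1) by (simp add: pair_graph_iff sym_avoiding)
  then have "sym (avoiding (parcs G) w \<union> {(a, b), (b, a)})"
    unfolding sym_def by blast
  moreover have "avoiding (parcs G) w \<subseteq> (pverts G - {w}) \<times> (pverts G - {w})"
    "irrefl (avoiding (parcs G) w)"
    using assms(1) by (auto simp: pair_graph_iff avoiding_def irrefl_def)
  ultimately show ?thesis
    using assms by (simp add: pair_graph_iff suppress_def irrefl_def)
qed

text \<open>A walk avoiding \<open>c\<close> is carried over by moving \<open>w\<close> to whichever
  of \<open>a\<close> and \<open>b\<close> differs from \<open>c\<close>. Arcs at \<open>w\<close>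
  then either collapse or become the edge \<open>ab\<close>.\<close>

lemma no_cut_vertex_suppress:
  assumes "pair_graph G" "no_cut_vertex G" "a \<noteq> b" "\<And>y. (w, y) \<in> parcs G \<Longrightarrow> y = a \<or> y = b"
  shows "no_cut_vertex (suppress G w a b)"
proof -
  let ?H = "suppress G w a b"
  have "(x, y) \<in> (avoiding (parcs ?H) c)\<^sup>*"
    if xy: "x \<in> pverts G - {w}" "y \<in> pverts G - {w}" "x \<noteq> c" "y \<noteq> c" for c x y
  proof -
    define d where "d = (if c = a then b else a)"
    define g where "g t = (if t = w then d else t)" for t
    let ?R = "(avoiding (parcs ?H) c)\<^sup>*"
    have d: "d \<noteq> c" "d = a \<or> d = b"
      using assms(3) by (auto simp: d_def)
    have irr: "(w, w) \<notin> parcs G" and symG: "\<And>s t. (s, t) \<in> parcs G \<Longrightarrow> (t, s) \<in> parcs G"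
      using assms(1) unfolding pair_graph_iff irrefl_def by (blast dest: symD)+
    have ab: "(a, b) \<in> parcs ?H" "(b, a) \<in> parcs ?H"
      by (simp_all add: suppress_def)
    have nbr: "(d, t) \<in> ?R \<and> (t, d) \<in> ?R" if "(w, t) \<in> parcs G" "t \<noteq> c" for t
    proof (cases "t = d")
      case False
      then have "(d, t) \<in> parcs ?H \<and> (t, d) \<in> parcs ?H"
        using assms(4)[OF that(1)] d(2) ab by auto
      then show ?thesis
        using d(1) that(2) by (simp add: avoiding_def r_into_rtrancl)
    qed simp
    have step: "(g s, g t) \<in> ?R" if st: "(s, t) \<in> avoiding (parcs G) c" for s t
    proof -
      have st': "(s, t) \<in> parcs G" "s \<noteq> c" "t \<noteq> c"
        using st by (simp_all add: avoiding_def)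
      consider "s = w" | "t = w" | "s \<noteq> w" "t \<noteq> w"
        by blast
      then show ?thesis
      proof cases
        case 1
        then show ?thesis
          using st' nbr[of t] irr by (auto simp: g_def)
      next
        case 2
        then show ?thesis
          using st' nbr[of s] irr symG[OF st'(1)] by (auto simp: g_def)
      next
        case 3
        then have "(s, t) \<in> avoiding (parcs ?H) c"
          using st' by (simp add: suppress_def avoiding_def)
        then show ?thesis
          using 3 by (simp add: g_def r_into_rtrancl)
      qed
    qed
    have "(x, y) \<in> (avoiding (parcs G) c)\<^sup>*"
      using assms(2) xy by (auto simp: no_cut_vertex_def)
    then have "(g x, g y) \<in> ?R"
    proof (induction rule: rtrancl_induct)
      case (step y z)
      then show ?case
        using \<open>\<And>s t. (s, t) \<in> avoiding (parcs G) c \<Longrightarrow> (g s, g t) \<in> ?R\<close>[of y z]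
        by (meson rtrancl_trans)
    qed simp
    then show ?thesis
      using xy by (simp add: g_def)
  qed
  moreover have "pverts ?H = pverts G - {w}"
    by (simp add: suppress_def)
  ultimately show ?thesis
    unfolding no_cut_vertex_def by blast
qed

text \<open>With the third vertex \<open>c\<close> deleted, \<open>p\<close> can only be connected
  to \<open>q\<close> by an edge, so the graph is a triangle.\<close>

lemma ear_tree_card_3:
  assumes "pair_graph G" "no_cut_vertex G" "card (pverts G) = 3"
  shows "ear_tree G"
proof -
  obtain x y z where V: "pverts G = {x, y, z}" "x \<noteq> y" "x \<noteq> z" "y \<noteq> z"
    using assms(3) by (auto simp: card_3_iff)
  have "(p, q) \<in> parcs G" if pq: "p \<in> {x, y, z}" "q \<in> {x, y, z}" "p \<noteq> q" for p q
  proof -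
    obtain c where c: "{x, y, z} = {p, q, c}" "c \<noteq> p" "c \<noteq> q"
      using pq V(2-4) by auto
    then obtain t where t: "(p, t) \<in> parcs G" "t \<noteq> c"
      using no_cut_vertex_nbr[OF assms(2), of p c] assms(3) V(1) pq(1) by auto
    then have "t \<in> {p, q, c}" "t \<noteq> p"
      using assms(1) c(1) V(1) unfolding pair_graph_iff irrefl_def by blast+
    then show ?thesis
      using t by auto
  qed
  moreover have "parcs G \<subseteq> {x, y, z} \<times> {x, y, z}" "(p, p) \<notin> parcs G" for p
    using assms(1) V(1) unfolding pair_graph_iff irrefl_def by blast+
  ultimately have "parcs G = {(x, y), (y, x), (y, z), (z, y), (x, z), (z, x)}"
    using V(2-4) by blast
  then have "G = cycle_graph (x # [y] @ [z])"
    using V(1) unfolding parcs_cycle_graph_ends[symmetric]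
    by (intro pair_pre_digraph.equality) (auto simp: parcs_cycle_graph)
  moreover have "is_cycle (cycle_graph (x # [y] @ [z]))"
    using V(2-4) by (intro is_cycleI) auto
  ultimately show ?thesis
    by (simp only: ear_tree_cycle)
qed

text \<open>The map \<open>f\<close> stays fixed throughout the induction: suppressing
  \<open>w\<close> only removes a vertex, and the edge \<open>ab\<close> goes to the edge
  \<open>pq\<close> of the smaller 2-tree.\<close>

lemma ear_tree_if_no_triangle_relation:
  assumes "pair_graph G" "no_cut_vertex G" "3 \<le> card (pverts G)" "two_tree T" "embeds f G T"
    "no_triangle_relation G"
  shows "ear_tree G"
  using assms
proof (induction "card (pverts G)" arbitrary: G T rule: less_induct)
  case less
  show ?case
  proof (cases "card (pverts G) = 3")
    case True
    then show ?thesis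
      using less.prems(1,2) by (intro ear_tree_card_3)
  next
    case False
    note G = less.prems(1)
    have "4 \<le> card (pverts G)"
      using False less.prems(3) by simp
    then obtain w T' p q where w: "w \<in> pverts G" "two_tree T'" "(p, q) \<in> parcs T'"
      "f ` (pverts G - {w}) \<subseteq> pverts T'"
      "\<forall>(x, y) \<in> avoiding (parcs G) w. (f x, f y) \<in> parcs T'"
      "\<forall>y. (w, y) \<in> parcs G \<longrightarrow> f y = p \<or> f y = q"
      using embeds_elimination_vertex[OF less.prems(4,5) G] by blast
    have inj: "inj_on f (pverts G)"
      using less.prems(5) by (simp add: embeds_def)
    have wf: "parcs G \<subseteq> pverts G \<times> pverts G" and sym: "sym (parcs G)" and irr: "\<And>x. (x, x) \<notin> parcs G"
      and fin: "finite (pverts G)"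
      using G by (simp_all add: pair_graph_iff irrefl_def)
    have "\<not> pverts G \<subseteq> {w}"
      using less.prems(3) card_mono[of "{w}" "pverts G"] by auto
    then obtain c where "c \<noteq> w"
      by blast
    then obtain a where a: "(w, a) \<in> parcs G"
      using no_cut_vertex_nbr[OF less.prems(2,3) w(1)] by blast
    then have "a \<noteq> w"
      using irr by blast
    then obtain b where b: "(w, b) \<in> parcs G" "b \<noteq> a"
      using no_cut_vertex_nbr[OF less.prems(2,3) w(1)] by blast
    then have "b \<noteq> w"
      using irr by blast
    have abV: "a \<in> pverts G" "b \<in> pverts G"
      using a b wf by auto
    then have "f a \<noteq> f b"
      using inj b(2) by (auto dest: inj_onD)
    \<comment> \<open>The distinct images of two neighbours exhaust \<open>p\<close> and
      \<open>q\<close>. Hence \<open>w\<close> has no third neighbour, and \<open>ab\<close> is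
      mapped to an edge of \<open>T'\<close>.\<close>
    then have pq: "{p, q} = {f a, f b}"
      using w(6) a b(1) by auto
    have nbrs: "y = a \<or> y = b" if "(w, y) \<in> parcs G" for y
    proof -
      have "f y = f a \<or> f y = f b"
        using w(6) that pq by (auto simp: doubleton_eq_iff)
      moreover have "y \<in> pverts G"
        using that wf by blast
      ultimately show ?thesis
        using inj abV by (auto dest: inj_onD)
    qed
    have wa: "(a, w) \<in> parcs G" and wb: "(b, w) \<in> parcs G"
      using a b(1) sym by (blast dest: symD)+
    have nbrs': "y = a \<or> y = b" if "(y, w) \<in> parcs G" for y
      using that nbrs sym by (blast dest: symD)
    have arcs: "parcs G = avoiding (parcs G) w \<union> {(a, w), (w, a), (w, b), (b, w)}"
      using a b(1) wa wb nbrs nbrs' by (auto simp: avoiding_def)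
    let ?H = "suppress G w a b"
    have H: "pair_graph ?H"
      using G abV \<open>a \<noteq> w\<close> \<open>b \<noteq> w\<close> b(2) by (intro pair_graph_suppress) auto
    have vertsH: "pverts ?H = pverts G - {w}" and arcsH: "parcs ?H = avoiding (parcs G) w \<union> {(a, b), (b, a)}"
      by (simp_all add: suppress_def)
    have cardH: "card (pverts ?H) = card (pverts G) - 1"
      using w(1) fin by (simp add: vertsH)
    have "(f a, f b) \<in> parcs T'" "(f b, f a) \<in> parcs T'"
      using pq w(3) pair_graph_two_tree[OF w(2)] unfolding pair_graph_iff
      by (auto simp: doubleton_eq_iff dest: symD)
    then have emb: "embeds f ?H T'"
      using w(4,5) inj unfolding embeds_def vertsH arcsH by (auto intro: inj_on_subset)
    have "no_cut_vertex ?H"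
      using G less.prems(2) b(2)[symmetric] nbrs by (rule no_cut_vertex_suppress)
    then have IH: "ear_tree ?H" if "no_triangle_relation ?H"
      using less.hyps[of ?H T'] H cardH \<open>4 \<le> card (pverts G)\<close> w(2) emb that by simp
    have abH: "(a, b) \<in> parcs ?H"
      by (simp add: arcsH)
    show ?thesis
    proof (cases "(a, b) \<in> parcs G")
      case True
      then have "(a, b) \<in> avoiding (parcs G) w" "(b, a) \<in> avoiding (parcs G) w"
        using \<open>a \<noteq> w\<close> \<open>b \<noteq> w\<close> sym by (auto simp: avoiding_def dest: symD)
      then have arcsH': "parcs ?H = avoiding (parcs G) w"
        using arcsH by blast
      have ear: "is_ear ?H a [w] b"
        using abH by (simp add: is_ear_def vertsH)
      have "parcs G = parcs (add_ear ?H a [w] b)"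
      proof -
        have "path_arcs (a # [w] @ [b]) = {(a, w), (w, a), (w, b), (b, w)}"
          by auto
        then show ?thesis
          unfolding parcs_add_ear arcsH' by (simp only: arcs[symmetric])
      qed
      then have eq: "G = add_ear ?H a [w] b"
        using w(1) by (intro pair_pre_digraph.equality) (auto simp: pverts_add_ear[OF H ear] vertsH)
      have "no_triangle_relation (add_ear ?H a [w] b)"
        unfolding eq[symmetric] by (rule less.prems(6))
      \<comment> \<open>Every induced cycle of \<open>?H\<close> stays induced when the ear is
        added, so a relation in \<open>?H\<close> would be one in \<open>G\<close>.\<close>
      then have "no_triangle_relation ?H"
        unfolding no_triangle_relation_def induced_cycle_add_ear_iff[OF H ear] by blast
      then have "ear_tree (add_ear ?H a [w] b)"
        by (intro ear_tree.ear IH ear)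
      then show ?thesis
        unfolding eq[symmetric] .
    next
      case False
      then have "(a, b) \<notin> avoiding (parcs G) w" "(b, a) \<notin> avoiding (parcs G) w"
        using sym by (auto simp: avoiding_def dest: symD)
      then have "parcs G = parcs (subdivide ?H (a, b) w)"
        unfolding arcs_subdivide arcsH using arcs by blast
      then have eq: "G = subdivide ?H (a, b) w"
        using w(1) by (intro pair_pre_digraph.equality) (auto simp: vertsH)
      have w': "w \<notin> pverts ?H"
        by (simp add: vertsH)
      have no: "no_triangle_relation (subdivide ?H (a, b) w)"
        unfolding eq[symmetric] by (rule less.prems(6))
      then have "ear_tree ?H"
        using no_triangle_relation_subdivideD[OF H abH w'] IH by blast
      moreover have "3 \<le> card (pverts ?H)"
        using cardH \<open>4 \<le> card (pverts G)\<close> by simp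
      \<comment> \<open>Twin cycles through \<open>ab\<close> would yield a relation after
        subdivision, which leaves the other alternative.\<close>
      ultimately have "ear_tree (subdivide ?H (a, b) w)"
        using ear_tree_subdivide_or_twin_cycles[OF _ abH w']
          twin_cycles_triangle_relation[OF H abH w'] no by blast
      then show ?thesis
        unfolding eq[symmetric] .
    qed
  qed
qed

theorem theorem5:
  fixes G :: "'a pair_pre_digraph"
  assumes "pair_graph G"
  shows "polygonal_2_tree G \<longleftrightarrow>
    two_connected G \<and> partial_2_tree G \<and> cycle_basis G {C. induced_cycle G C}"
proof
  assume "polygonal_2_tree G"
  then have "ear_tree G" "3 \<le> card (pverts G)"
    using ear_tree_if_polygonal_2_tree by blast+
  then show "two_connected G \<and> partial_2_tree G \<and> cycle_basis G {C. induced_cycle G C}"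
    using two_connected_iff[OF assms] no_cut_vertex_ear_tree partial_2_tree_ear_tree
      cycle_basis_ear_tree by blast
next
  assume *: "two_connected G \<and> partial_2_tree G \<and> cycle_basis G {C. induced_cycle G C}"
  then have G: "no_cut_vertex G" "3 \<le> card (pverts G)"
    using two_connected_iff[OF assms] by simp_all
  obtain f :: "'a \<Rightarrow> nat" and T where "two_tree T" "embeds f G T"
    using * partial_2_tree_iff[OF assms] by blast
  moreover have "no_triangle_relation G"
    using * no_triangle_relation_if_cycle_basis[OF assms] by blast
  ultimately have "ear_tree G"
    using ear_tree_if_no_triangle_relation[OF assms G] by blast
  then show "polygonal_2_tree G"
    using G(2) by (rule polygonal_2_tree_if_ear_tree)
qed

end
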